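(* Let $n\ge 3$. For $2n-2$ spheres in $\mathbb{R}^n$ with general centers $c_1,\ldots,c_{2n-2}$ and radii $r_1,\ldots,r_{2n-2}$, there are exactly $3\cdot 2^{n-1}$ complex lines tangent to all of them. Moreover, there exist $2n-2$ spheres in $\mathbb{R}^n$ having exactly $3\cdot 2^{n-1}$ complex common tangent lines, all of which are real.
   Context: A (complex) line in $\mathbb{C}^n$ is represented by a pair $(p,v)$ with $p\in\mathbb{C}^n$ a point on the line and $v\in\mathbb{P}^{n-1}$ its direction, normalized uniquely by $p\cdot v=0$, where $\cdot$ is the Euclidean bilinear dot product and $v^2:=v\cdot v$. The line $(p,v)$ is tangent to the sphere with center $c$ and radius $r$ when $v^2p^2-2v^2\,p\cdot c+v^2c^2-(v\cdot c)^2-r^2v^2=0$. *)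

theory Defs
  imports "HOL-Analysis.Analysis"
begin

definition cdot :: "complex^'n \<Rightarrow> complex^'n \<Rightarrow> complex" where
  "cdot x y = (\<Sum>i\<in>UNIV. x$i * y$i)"

definition cvec :: "real^'n \<Rightarrow> complex^'n" where
  "cvec x = (\<chi> i. complex_of_real (x$i))"

definition line_of :: "complex^'n \<Rightarrow> complex^'n \<Rightarrow> (complex^'n) set" where
  "line_of p v = {(\<chi> i. p$i + t * v$i) | t. True}"

definition is_cline :: "(complex^'n) set \<Rightarrow> bool" where
  "is_cline L \<longleftrightarrow> (\<exists>p v. v \<noteq> 0 \<and> L = line_of p v)"

definition tangent_eq :: "complex^'n \<Rightarrow> complex^'n \<Rightarrow> complex^'n \<Rightarrow> complex \<Rightarrow> bool" where
  "tangent_eq p v c r \<longleftrightarrow>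
     cdot v v * cdot p p - 2 * cdot v v * cdot p c + cdot v v * cdot c c
       - (cdot v c)^2 - r^2 * cdot v v = 0"

definition tangent_line :: "(complex^'n) set \<Rightarrow> real^'n \<Rightarrow> real \<Rightarrow> bool" where
  "tangent_line L c r \<longleftrightarrow>
     (\<exists>p v. v \<noteq> 0 \<and> L = line_of p v \<and> cdot p v = 0 \<and>
            tangent_eq p v (cvec c) (complex_of_real r))"

definition common_tangents :: "nat \<Rightarrow> (nat \<Rightarrow> real^'n) \<Rightarrow> (nat \<Rightarrow> real) \<Rightarrow> (complex^'n) set set" where
  "common_tangents m c r = {L. is_cline L \<and> (\<forall>i<m. tangent_line L (c i) (r i))}"

definition real_line :: "(complex^'n) set \<Rightarrow> bool" where
  "real_line L \<longleftrightarrow> (\<exists>p v. v \<noteq> (0::real^'n) \<and> L = line_of (cvec p) (cvec v))"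

inductive polyfun :: "(('v \<Rightarrow> real) \<Rightarrow> real) \<Rightarrow> bool" where
  const: "polyfun (\<lambda>x. a)"
| var: "polyfun (\<lambda>x. x k)"
| add: "polyfun f \<Longrightarrow> polyfun g \<Longrightarrow> polyfun (\<lambda>x. f x + g x)"
| mult: "polyfun f \<Longrightarrow> polyfun g \<Longrightarrow> polyfun (\<lambda>x. f x * g x)"

definition sphere_params :: "(nat \<Rightarrow> real^'n) \<Rightarrow> (nat \<Rightarrow> real) \<Rightarrow> (nat \<times> 'n option \<Rightarrow> real)" where
  "sphere_params c r = (\<lambda>(i, j). case j of None \<Rightarrow> r i | Some k \<Rightarrow> c i $ k)"

end

theory Submission
  imports Defs "HOL-Computational_Algebra.Fundamental_Theorem_Algebra"
begin

text \<open>
  If the centers span, no common tangent is isotropic, so a common tangent has exactly two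
  representatives \<open>(p, \<plusminus>v)\<close> with \<open>v\<^sup>2 = 1\<close>, and it suffices to count the solutions \<open>(p, v)\<close>
  of a polynomial system. By quantifier elimination over \<open>\<complex>\<close>, the condition that there are exactly
  \<open>3 \<cdot> 2\<^sup>n\<close> of them is a Boolean combination of polynomial equations in the parameters, hence has
  a constant truth value off the zero set of some nonzero polynomial. It therefore suffices to find
  one configuration near which the count is right on every line of parameters through it. For four
  equal spheres at the vertices of a regular tetrahedron in the first three coordinates and pairs
  of spheres at \<open>\<plusminus>a e\<^sub>j\<close> on the remaining axes the system can be solved explicitly: the squares of
  the coordinates of \<open>v\<close> are determined up to permuting \<open>0, X, Y\<close>, all solutions are real, the
  Jacobian is injective at each of them, and there are no solutions at infinity. The inverse function
  theorem and compactness then show that the number of solutions persists under small perturbations.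
\<close>

subsection \<open>Projections of constructible sets over the complex numbers\<close>

text \<open>Elimination produces the exceptional polynomial without control over it, and a
  configuration as symmetric as the tetrahedral one may well be among its zeros, so a correct count
  there alone decides nothing. Joining it to a point where the polynomial is nonzero leaves only
  finitely many bad parameters on the line; since the direction of that line is unknown, the count
  must persist in every direction. Two things could destroy it: zeros splitting or merging, excluded
  by nondegeneracy, and zeros arriving from infinity, excluded by a weighted compactification. The
  constant is read off the example. One of three coordinates of \<open>v\<close> vanishes, the
  squares \<open>0\<close>, \<open>X\<close>, \<open>Y\<close> have six arrangements, and each
  leaves \<open>2 ^ (n - 1)\<close> choices of sign; halving for \<open>v\<close> and
  \<open>- v\<close> gives \<open>3 * 2 ^ (n - 1)\<close>. The tetrahedron is chosen because the
  sign patterns of its vertices form a group, whose characters separate the four equations; each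
  further axis only doubles the count. The values \<open>X\<close> and \<open>Y\<close> must differ,
  as equal ones would make solutions coincide.\<close>

inductive constructible :: "(('a \<Rightarrow> complex) \<Rightarrow> bool) \<Rightarrow> ('a \<Rightarrow> bool) \<Rightarrow> bool" for R where
  atom: "R f \<Longrightarrow> constructible R (\<lambda>a. f a = 0)"
| neg: "constructible R \<phi> \<Longrightarrow> constructible R (\<lambda>a. \<not> \<phi> a)"
| conj: "constructible R \<phi> \<Longrightarrow> constructible R \<psi> \<Longrightarrow> constructible R (\<lambda>a. \<phi> a \<and> \<psi> a)"

lemma constructible_disj:
  assumes "constructible R \<phi>" "constructible R \<psi>"
  shows "constructible R (\<lambda>a. \<phi> a \<or> \<psi> a)"
proof -
  have "constructible R (\<lambda>a. \<not> (\<not> \<phi> a \<and> \<not> \<psi> a))"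
    using assms by (intro constructible.intros)
  then show ?thesis by simp
qed

text \<open>Substitution on the level of atoms: with \<open>g\<close> overwriting one unknown, it
  turns a condition on all unknowns into one on polynomials in that unknown.\<close>

lemma constructible_map:
  assumes "constructible R \<phi>" "\<And>f. R f \<Longrightarrow> S (\<lambda>b. f (g b))"
  shows "constructible S (\<lambda>b. \<phi> (g b))"
  using assms(1)
proof induction
  case (atom f)
  show ?case by (intro constructible.atom[of S "\<lambda>b. f (g b)"] assms(2) atom)
qed (auto intro: constructible.intros)

section \<open>Polynomials in one unknown with coefficients depending on parameters\<close>

locale function_ring =
  fixes R :: "('a \<Rightarrow> complex) \<Rightarrow> bool"
  assumes R_const: "R (\<lambda>a. c)"
    and R_add: "R f \<Longrightarrow> R g \<Longrightarrow> R (\<lambda>a. f a + g a)"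
    and R_mult: "R f \<Longrightarrow> R g \<Longrightarrow> R (\<lambda>a. f a * g a)"
begin

lemma R_diff: "R f \<Longrightarrow> R g \<Longrightarrow> R (\<lambda>a. f a - g a)"
  using R_add[of f "\<lambda>a. (-1) * g a"] R_mult[OF R_const, of g "-1"] by simp

lemma R_sum: "(\<And>i. i \<in> A \<Longrightarrow> R (f i)) \<Longrightarrow> R (\<lambda>a. \<Sum>i\<in>A. f i a)"
  by (induction A rule: infinite_finite_induct) (auto intro: R_const R_add)

lemma constructible_const: "constructible R (\<lambda>a. P)"
proof -
  have T: "constructible R (\<lambda>a. True)"
    using constructible.atom[of R "\<lambda>a. 0"] R_const[of 0] by simp
  show ?thesis
    using T constructible.neg[OF T] by (cases P) auto
qed

lemma constructible_ball:
  "finite A \<Longrightarrow> (\<And>i. i \<in> A \<Longrightarrow> constructible R (\<phi> i)) \<Longrightarrow> constructible R (\<lambda>a. \<forall>i\<in>A. \<phi> i a)"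
  by (induction A rule: finite_induct) (auto intro: constructible_const constructible.conj)

text \<open>Case distinction on a constructible condition; elimination branches on whether a leading
  coefficient vanishes.\<close>

lemma constructible_split:
  assumes "constructible R (\<lambda>a. \<phi> a \<and> l a)" "constructible R (\<lambda>a. \<not> \<phi> a \<and> l a)"
  shows "constructible R l"
  using constructible_disj[OF assms] by (rule back_subst[of "constructible R"]) auto

text \<open>The bound \<open>n\<close> acts as a formal degree. The true degree jumps where a
  leading coefficient vanishes, so only a bound uniform in the parameters can drive an induction;
  bound \<open>0\<close> forces the zero polynomial.\<close>

definition param_poly :: "nat \<Rightarrow> ('a \<Rightarrow> complex poly) \<Rightarrow> bool" where
  "param_poly n p \<longleftrightarrow> (\<forall>i. R (\<lambda>a. coeff (p a) i)) \<and> (\<forall>a i. n \<le> i \<longrightarrow> coeff (p a) i = 0)"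

lemma param_poly_const: "R f \<Longrightarrow> param_poly 1 (\<lambda>a. [:f a:])"
  unfolding param_poly_def
proof safe
  show "R f \<Longrightarrow> R (\<lambda>a. coeff [:f a:] i)" for i by (cases i) (auto intro: R_const)
qed (auto simp: coeff_pCons split: nat.splits)

lemma param_poly_fixed: "param_poly (Suc (degree q)) (\<lambda>a. q)"
  by (auto simp: param_poly_def R_const coeff_eq_0)

lemma param_poly_add: "param_poly n p \<Longrightarrow> param_poly m q \<Longrightarrow> param_poly (max n m) (\<lambda>a. p a + q a)"
  by (auto simp: param_poly_def R_add)

lemma param_poly_mult:
  assumes "param_poly n p" "param_poly m q"
  shows "param_poly (n + m) (\<lambda>a. p a * q a)"
  unfolding param_poly_def
proof safe
  show "R (\<lambda>a. coeff (p a * q a) i)" for i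
    unfolding coeff_mult using assms by (intro R_sum R_mult) (auto simp: param_poly_def)
  show "coeff (p a * q a) i = 0" if "n + m \<le> i" for a i
    unfolding coeff_mult
  proof (intro sum.neutral ballI)
    fix j assume "j \<in> {..i}"
    then have "n \<le> j \<or> m \<le> i - j" using that by auto
    then show "coeff (p a) j * coeff (q a) (i - j) = 0"
      using assms by (auto simp: param_poly_def)
  qed
qed

lemma param_poly_power:
  assumes "param_poly n p"
  shows "\<exists>m. param_poly m (\<lambda>a. p a ^ k)"
proof (induction k)
  case 0
  then show ?case using param_poly_fixed[of 1] by auto
next
  case (Suc k)
  then show ?case using param_poly_mult[OF assms] by auto
qed

lemma constructible_poly_zero:
  assumes "param_poly n p"
  shows "constructible R (\<lambda>a. p a = 0)"
proof -
  have "constructible R (\<lambda>a. \<forall>i\<in>{..<n}. coeff (p a) i = 0)"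
    using assms by (intro constructible_ball constructible.atom) (auto simp: param_poly_def)
  moreover have "(\<forall>i\<in>{..<n}. coeff (p a) i = 0) \<longleftrightarrow> p a = 0" for a
    using assms by (auto simp: param_poly_def poly_eq_iff) (meson lessThan_iff not_le)
  ultimately show ?thesis by simp
qed

text \<open>Where the coefficient at \<open>d\<close> vanishes the polynomial is unchanged.
  Subtracting the top term makes the smaller bound valid for every parameter, as
  \<open>param_poly\<close> demands, and not only on that locus.\<close>

lemma param_poly_drop_lead:
  assumes "param_poly (Suc d) p"
  shows "param_poly d (\<lambda>a. p a - monom (coeff (p a) d) d)"
  unfolding param_poly_def
proof safe
  show "R (\<lambda>a. coeff (p a - monom (coeff (p a) d) d) i)" for i
    using assms by (cases "i = d") (auto simp: param_poly_def R_const)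
  show "coeff (p a - monom (coeff (p a) d) d) i = 0" if "d \<le> i" for a i
    using assms that by (cases "i = d") (auto simp: param_poly_def)
qed

text \<open>One step of pseudo-division by \<open>p\<close>.\<close>

lemma param_poly_reduce:
  assumes p: "param_poly (Suc d) p" and s: "param_poly (Suc m) s" and "d \<le> m"
  shows "param_poly m (\<lambda>a. smult (coeff (p a) d) (s a) - monom (coeff (s a) m) (m - d) * p a)"
proof -
  have "R (\<lambda>a. coeff (smult (coeff (p a) d) (s a) - monom (coeff (s a) m) (m - d) * p a) i)" for i
    unfolding coeff_diff coeff_smult coeff_monom_mult
    using p s by (cases "m - d \<le> i") (auto intro!: R_diff R_mult R_const simp: param_poly_def)
  moreover have "coeff (smult (coeff (p a) d) (s a) - monom (coeff (s a) m) (m - d) * p a) i = 0"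
    if "m \<le> i" for a i
  proof (cases "i = m")
    case True
    then show ?thesis using \<open>d \<le> m\<close> by (simp add: coeff_monom_mult)
  next
    case False
    then have "Suc m \<le> i" "Suc d \<le> i - (m - d)" using that \<open>d \<le> m\<close> by auto
    then show ?thesis using p s by (auto simp: coeff_monom_mult param_poly_def)
  qed
  ultimately show ?thesis by (auto simp: param_poly_def)
qed

lemma param_poly_degree:
  assumes "param_poly (Suc d) p" "coeff (p a) d \<noteq> 0"
  shows "degree (p a) = d"
  using assms by (intro antisym degree_le le_degree) (auto simp: param_poly_def)

text \<open>Where the coefficient at \<open>d\<close> is nonzero, \<open>p a\<close> has degree
  exactly \<open>d\<close>; multiplying \<open>s a\<close> by this unit and cancelling its top term
  does not affect divisibility by \<open>p a\<close>. Once the bound is at most \<open>d\<close>,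
  degrees leave \<open>0\<close> as the only multiple.\<close>

lemma constructible_dvd:
  assumes p: "param_poly (Suc d) p"
  shows "param_poly m s \<Longrightarrow> constructible R (\<lambda>a. coeff (p a) d \<noteq> 0 \<and> p a dvd s a)"
proof (induction m arbitrary: s)
  case 0
  then have "s a = 0" for a by (auto simp: param_poly_def poly_eq_iff)
  then show ?case
    using p by (auto simp: param_poly_def intro!: constructible.intros)
next
  case (Suc m)
  show ?case
  proof (cases "d \<le> m")
    case True
    define s' where "s' = (\<lambda>a. smult (coeff (p a) d) (s a) - monom (coeff (s a) m) (m - d) * p a)"
    have "constructible R (\<lambda>a. coeff (p a) d \<noteq> 0 \<and> p a dvd s' a)"
      using Suc.IH param_poly_reduce[OF p Suc.prems True] by (simp add: s'_def)
    moreover have "p a dvd s' a \<longleftrightarrow> p a dvd s a" if "coeff (p a) d \<noteq> 0" for a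
      unfolding s'_def
    proof
      assume "p a dvd s a"
      then show "p a dvd smult (coeff (p a) d) (s a) - monom (coeff (s a) m) (m - d) * p a"
        by (intro dvd_diff dvd_smult) auto
    next
      assume "p a dvd smult (coeff (p a) d) (s a) - monom (coeff (s a) m) (m - d) * p a"
      then have "p a dvd smult (coeff (p a) d) (s a)"
        by (metis diff_add_cancel dvd_add dvd_triv_right)
      then show "p a dvd s a" using that by (simp add: dvd_smult_iff)
    qed
    ultimately show ?thesis by (simp cong: conj_cong)
  next
    case False
    have "p a dvd s a \<longleftrightarrow> s a = 0" if "coeff (p a) d \<noteq> 0" for a
    proof
      assume "p a dvd s a"
      have "degree (s a) \<le> m"
        using Suc.prems by (intro degree_le) (auto simp: param_poly_def)
      then have "degree (s a) < degree (p a)"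
        using False param_poly_degree[OF p that] by simp
      then show "s a = 0" using \<open>p a dvd s a\<close> dvd_imp_degree_le not_less by blast
    qed auto
    moreover have "constructible R (\<lambda>a. coeff (p a) d \<noteq> 0 \<and> s a = 0)"
      using p by (intro constructible.intros constructible_poly_zero[OF Suc.prems])
        (auto simp: param_poly_def)
    ultimately show ?thesis by (simp cong: conj_cong)
  qed
qed

text \<open>By the univariate Nullstellensatz every root of \<open>p a\<close> is a root of
  \<open>q a\<close> iff \<open>p a\<close> divides \<open>q a ^ d\<close>, since no root has
  multiplicity above the degree \<open>d\<close>. Existence of a root thus becomes
  non-divisibility.\<close>

lemma constructible_single:
  assumes p: "param_poly (Suc d) p" and q: "param_poly m q"
  shows "constructible R (\<lambda>a. coeff (p a) d \<noteq> 0 \<and> (\<exists>z. poly (p a) z = 0 \<and> poly (q a) z \<noteq> 0))"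
proof -
  obtain k where k: "param_poly k (\<lambda>a. q a ^ d)" using param_poly_power[OF q] by blast
  have "constructible R (\<lambda>a. coeff (p a) d \<noteq> 0 \<and> \<not> (coeff (p a) d \<noteq> 0 \<and> p a dvd q a ^ d))"
    using p by (intro constructible.intros constructible_dvd[OF p k]) (auto simp: param_poly_def)
  moreover have "p a dvd q a ^ d \<longleftrightarrow> (\<forall>z. poly (p a) z = 0 \<longrightarrow> poly (q a) z = 0)"
    if "coeff (p a) d \<noteq> 0" for a
    using nullstellensatz_univariate[of "p a" "q a"] param_poly_degree[OF p that] that by auto
  ultimately show ?thesis by (simp cong: conj_cong)
qed

section \<open>Eliminating one unknown from equations and one inequation\<close>

definition basic_set :: "(nat \<times> ('a \<Rightarrow> complex poly)) list \<Rightarrow> ('a \<Rightarrow> complex poly) \<Rightarrow> 'a \<Rightarrow> complex \<Rightarrow> bool" where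
  "basic_set L q a z \<longleftrightarrow> (\<forall>(n, p)\<in>set L. poly (p a) z = 0) \<and> poly (q a) z \<noteq> 0"

text \<open>A Euclidean algorithm that branches on parameters. Take an equation of least bound:
  where its leading coefficient vanishes, its bound drops; elsewhere it reduces another equation,
  whose bound is at least as large by minimality, or, if it is the only one,
  \<open>constructible_single\<close> applies.\<close>

lemma constructible_ex_basic:
  assumes q: "param_poly m q" and "\<forall>(n, p)\<in>set L. param_poly n p"
  shows "constructible R (\<lambda>a. \<exists>z. basic_set L q a z)"
  using assms(2)
\<comment> \<open>Counting the entries as well makes the measure decrease when an equation with
  bound \<open>0\<close> is discarded.\<close>
proof (induction "sum_list (map fst L) + length L" arbitrary: L rule: less_induct)
  case less
  show ?case
  proof (cases "L = []")
    case True
    have "(\<exists>z. basic_set L q a z) \<longleftrightarrow> \<not> q a = 0" for a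
      using poly_all_0_iff_0[of "q a"] by (auto simp: True basic_set_def)
    then show ?thesis
      using constructible.neg[OF constructible_poly_zero[OF q]] by simp
  next
    case False
    then have "Min (fst ` set L) \<in> fst ` set L" by (intro Min_in) auto
    then obtain n p where np: "(n, p) \<in> set L" "n = Min (fst ` set L)" by auto
    then have min: "n \<le> k" if "(k, s) \<in> set L" for k s
      using that by (force intro: Min_le)
    obtain L1 L2 where L: "L = L1 @ (n, p) # L2" using np(1) by (meson split_list)
    define L' where "L' = L1 @ L2"
    have setL: "set L = insert (n, p) (set L')" by (auto simp: L L'_def)
    have size: "sum_list (map fst L) + length L = Suc n + (sum_list (map fst L') + length L')"
      by (simp add: L L'_def)
    have pp: "param_poly n p" and ppL': "\<forall>(n, p)\<in>set L'. param_poly n p"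
      using less.prems by (auto simp: setL)
    show ?thesis
    proof (cases n)
      case 0
      then have "poly (p a) z = 0" for a z
        using pp by (simp add: param_poly_def poly_altdef)
      then have "basic_set L q = basic_set L' q"
        by (auto simp: basic_set_def setL fun_eq_iff)
      then show ?thesis using less.hyps[of L'] size ppL' by simp
    next
      case (Suc d)
      let ?l = "\<lambda>a. coeff (p a) d"
      have Rl: "constructible R (\<lambda>a. ?l a = 0)"
        using pp by (intro constructible.atom) (auto simp: param_poly_def)
      have pp': "param_poly (Suc d) p" using pp Suc by simp
      define p' where "p' = (\<lambda>a. p a - monom (?l a) d)"
      have "param_poly d p'" using param_poly_drop_lead[OF pp'] by (simp add: p'_def)
      then have "constructible R (\<lambda>a. \<exists>z. basic_set ((d, p') # L') q a z)"
        using less.hyps[of "(d, p') # L'"] ppL' size Suc by auto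
      then have "constructible R (\<lambda>a. ?l a = 0 \<and> (\<exists>z. basic_set ((d, p') # L') q a z))"
        using Rl by (intro constructible.conj)
      moreover have "basic_set ((d, p') # L') q a z \<longleftrightarrow> basic_set L q a z" if "?l a = 0" for a z
        using that by (auto simp: basic_set_def p'_def setL)
      ultimately have 1: "constructible R (\<lambda>a. ?l a = 0 \<and> (\<exists>z. basic_set L q a z))"
        by (simp cong: conj_cong)
      have 2: "constructible R (\<lambda>a. ?l a \<noteq> 0 \<and> (\<exists>z. basic_set L q a z))"
      proof (cases L')
        case Nil
        then show ?thesis
          using constructible_single[OF pp' q] by (simp add: basic_set_def setL)
      next
        case (Cons ks L'')
        obtain k s where ks: "ks = (k, s)" by fastforce
        have "n \<le> k" using min[of k s] by (simp add: setL Cons ks)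
        then obtain e where e: "k = Suc e" "d \<le> e" using Suc by (cases k) auto
        define s' where "s' = (\<lambda>a. smult (?l a) (s a) - monom (coeff (s a) e) (e - d) * p a)"
        have "param_poly k s" using ppL' by (simp add: Cons ks)
        then have "param_poly e s'"
          using param_poly_reduce[OF pp' _ e(2)] by (simp add: s'_def e(1))
        then have "constructible R (\<lambda>a. \<exists>z. basic_set ((n, p) # (e, s') # L'') q a z)"
          using less.hyps[of "(n, p) # (e, s') # L''"] ppL' pp size by (auto simp: Cons ks e)
        then have "constructible R (\<lambda>a. ?l a \<noteq> 0 \<and> (\<exists>z. basic_set ((n, p) # (e, s') # L'') q a z))"
          using Rl by (intro constructible.conj constructible.neg)
        moreover have "basic_set ((n, p) # (e, s') # L'') q a z \<longleftrightarrow> basic_set L q a z"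
          if "?l a \<noteq> 0" for a z
          using that by (auto simp: basic_set_def setL Cons ks s'_def)
        ultimately show ?thesis by (simp cong: conj_cong)
      qed
      show ?thesis using constructible_split[OF 1 2] .
    qed
  qed
qed

section \<open>From basic systems to arbitrary Boolean combinations\<close>

definition fibre_ring :: "('a \<times> complex \<Rightarrow> complex) \<Rightarrow> bool" where
  "fibre_ring f \<longleftrightarrow> (\<exists>n p. param_poly n p \<and> (\<forall>a z. f (a, z) = poly (p a) z))"

text \<open>Disjunctive normal form; a clause has a single inequation because several inequations
  multiply into one.\<close>

definition basic_union :: "('a \<times> complex \<Rightarrow> bool) \<Rightarrow> bool" where
  "basic_union \<phi> \<longleftrightarrow> (\<exists>C. (\<forall>(L, q)\<in>set C. (\<forall>(n, p)\<in>set L. param_poly n p) \<and> (\<exists>m. param_poly m q)) \<and>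
     (\<forall>a z. \<phi> (a, z) \<longleftrightarrow> (\<exists>(L, q)\<in>set C. basic_set L q a z)))"

lemma basic_union_disj:
  assumes "basic_union \<phi>" "basic_union \<psi>"
  shows "basic_union (\<lambda>x. \<phi> x \<or> \<psi> x)"
proof -
  obtain C where C: "\<forall>(L, q)\<in>set C. (\<forall>(n, p)\<in>set L. param_poly n p) \<and> (\<exists>m. param_poly m q)"
     "\<forall>a z. \<phi> (a, z) \<longleftrightarrow> (\<exists>(L, q)\<in>set C. basic_set L q a z)"
    using assms(1) unfolding basic_union_def by blast
  obtain D where D: "\<forall>(L, q)\<in>set D. (\<forall>(n, p)\<in>set L. param_poly n p) \<and> (\<exists>m. param_poly m q)"
     "\<forall>a z. \<psi> (a, z) \<longleftrightarrow> (\<exists>(L, q)\<in>set D. basic_set L q a z)"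
    using assms(2) unfolding basic_union_def by blast
  show ?thesis
    unfolding basic_union_def using C D by (intro exI[of _ "C @ D"]) (simp add: ball_Un bex_Un)
qed

lemma basic_union_conj:
  assumes "basic_union \<phi>" "basic_union \<psi>"
  shows "basic_union (\<lambda>x. \<phi> x \<and> \<psi> x)"
proof -
  obtain C where C: "\<forall>(L, q)\<in>set C. (\<forall>(n, p)\<in>set L. param_poly n p) \<and> (\<exists>m. param_poly m q)"
     "\<forall>a z. \<phi> (a, z) \<longleftrightarrow> (\<exists>(L, q)\<in>set C. basic_set L q a z)"
    using assms(1) unfolding basic_union_def by blast
  obtain D where D: "\<forall>(L, q)\<in>set D. (\<forall>(n, p)\<in>set L. param_poly n p) \<and> (\<exists>m. param_poly m q)"
     "\<forall>a z. \<psi> (a, z) \<longleftrightarrow> (\<exists>(L, q)\<in>set D. basic_set L q a z)"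
    using assms(2) unfolding basic_union_def by blast
  define B where "B = map (\<lambda>((L, q), (L', q')). (L @ L', \<lambda>a. q a * q' a)) (List.product C D)"
  have "(\<forall>(n, p)\<in>set L. param_poly n p) \<and> (\<exists>m. param_poly m q)" if "(L, q) \<in> set B" for L q
  proof -
    have "(L, q) \<in> (\<lambda>(c, d). (fst c @ fst d, \<lambda>a. snd c a * snd d a)) ` (set C \<times> set D)"
      using that by (simp add: B_def split_def)
    then obtain x where x: "x \<in> set C \<times> set D" "(L, q) = (\<lambda>(c, d). (fst c @ fst d, \<lambda>a. snd c a * snd d a)) x"
      by (rule imageE)
    obtain L1 q1 L2 q2 where "x = ((L1, q1), (L2, q2))" by (cases x) auto
    with x have *: "(L1, q1) \<in> set C" "(L2, q2) \<in> set D" "L = L1 @ L2" "q = (\<lambda>a. q1 a * q2 a)"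
      by auto
    then obtain m1 m2 where "param_poly m1 q1" "param_poly m2 q2" using C(1) D(1) by blast
    then have "param_poly (m1 + m2) q" unfolding * by (rule param_poly_mult)
    moreover have "\<forall>(n, p)\<in>set L. param_poly n p" using * C(1) D(1) by fastforce
    ultimately show ?thesis by blast
  qed
  moreover have "\<phi> (a, z) \<and> \<psi> (a, z) \<longleftrightarrow> (\<exists>(L, q)\<in>set B. basic_set L q a z)" for a z
  proof -
    have "basic_set (L @ L') (\<lambda>a. q a * q' a) a z \<longleftrightarrow> basic_set L q a z \<and> basic_set L' q' a z" for L L' q q'
      by (auto simp: basic_set_def)
    then show ?thesis
      unfolding B_def C(2)[rule_format] D(2)[rule_format] by (simp add: split_def)
  qed
  ultimately show ?thesis unfolding basic_union_def by (intro exI[of _ B]) blast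
qed

text \<open>Negating a disjunctive normal form directly is awkward. The induction carries each
  condition together with its complement, and negation merely swaps the two.\<close>

lemma basic_union_constructible:
  "constructible fibre_ring \<phi> \<Longrightarrow> basic_union \<phi> \<and> basic_union (\<lambda>x. \<not> \<phi> x)"
proof (induction rule: constructible.induct)
  case (atom f)
  then obtain n p where p: "param_poly n p" "\<forall>a z. f (a, z) = poly (p a) z"
    unfolding fibre_ring_def by blast
  have "basic_union (\<lambda>x. f x = 0)"
    unfolding basic_union_def using p param_poly_fixed[of 1]
    by (intro exI[of _ "[([(n, p)], \<lambda>a. 1)]"]) (auto simp: basic_set_def)
  moreover have "basic_union (\<lambda>x. f x \<noteq> 0)"
    unfolding basic_union_def using p
    by (intro exI[of _ "[([], p)]"]) (auto simp: basic_set_def)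
  ultimately show ?case by simp
next
  case (conj \<phi> \<psi>)
  then show ?case
    using basic_union_conj[of \<phi> \<psi>] basic_union_disj[of "\<lambda>x. \<not> \<phi> x" "\<lambda>x. \<not> \<psi> x"] by simp
qed simp

theorem constructible_projection:
  assumes "constructible fibre_ring \<phi>"
  shows "constructible R (\<lambda>a. \<exists>z. \<phi> (a, z))"
proof -
  obtain C where C: "\<forall>(L, q)\<in>set C. (\<forall>(n, p)\<in>set L. param_poly n p) \<and> (\<exists>m. param_poly m q)"
     "\<And>a z. \<phi> (a, z) \<longleftrightarrow> (\<exists>(L, q)\<in>set C. basic_set L q a z)"
    using basic_union_constructible[OF assms] unfolding basic_union_def by blast
  from C(1) have "constructible R (\<lambda>a. \<exists>(L, q)\<in>set C. \<exists>z. basic_set L q a z)"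
  proof (induction C)
    case Nil
    then show ?case by (simp add: constructible_const)
  next
    case (Cons Lq C)
    then show ?case
      by (auto simp: split_def intro!: constructible_disj constructible_ex_basic)
  qed
  moreover have "(\<exists>(L, q)\<in>set C. \<exists>z. basic_set L q a z) \<longleftrightarrow> (\<exists>z. \<phi> (a, z))" for a
    using C(2) by blast
  ultimately show ?thesis by simp
qed

end

subsection \<open>Polynomial functions of real parameters and complex unknowns\<close>

text \<open>Unknowns are complex because elimination relies on algebraic closedness, while spheres
  are real and the exceptional polynomial is one in real parameters.\<close>

inductive mixed_polyfun :: "(('p \<Rightarrow> real) \<times> ('w \<Rightarrow> complex) \<Rightarrow> complex) \<Rightarrow> bool" where
  const: "mixed_polyfun (\<lambda>a. c)"
| param: "mixed_polyfun (\<lambda>a. complex_of_real (fst a k))"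
| unknown: "mixed_polyfun (\<lambda>a. snd a w)"
| add: "mixed_polyfun f \<Longrightarrow> mixed_polyfun g \<Longrightarrow> mixed_polyfun (\<lambda>a. f a + g a)"
| mult: "mixed_polyfun f \<Longrightarrow> mixed_polyfun g \<Longrightarrow> mixed_polyfun (\<lambda>a. f a * g a)"

interpretation mixed: function_ring mixed_polyfun
  by unfold_locales (auto intro: mixed_polyfun.intros)

abbreviation mixed_constructible ::
  "(('p \<Rightarrow> real) \<times> ('w \<Rightarrow> complex) \<Rightarrow> bool) \<Rightarrow> bool" where
  "mixed_constructible \<equiv> constructible mixed_polyfun"

lemma mixed_constructible_eq:
  assumes "mixed_polyfun f" "mixed_polyfun g"
  shows "mixed_constructible (\<lambda>a. f a = g a)"
  using constructible.atom[of mixed_polyfun, OF mixed.R_diff[OF assms]] by simp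

lemma mixed_fibre:
  "mixed_polyfun f \<Longrightarrow> mixed.fibre_ring (\<lambda>b. f (fst (fst b), (snd (fst b))(w := snd b)))"
proof (induction rule: mixed_polyfun.induct)
  case (const c)
  then show ?case unfolding mixed.fibre_ring_def
    using mixed.param_poly_fixed[of "[:c:]"] by (intro exI[of _ 1] exI[of _ "\<lambda>a. [:c:]"]) auto
next
  case (param k)
  then show ?case unfolding mixed.fibre_ring_def
    using mixed.param_poly_const[OF mixed_polyfun.param]
    by (intro exI[of _ 1] exI[of _ "\<lambda>a. [:complex_of_real (fst a k):]"]) auto
next
  case (unknown v)
  show ?case
  proof (cases "v = w")
    case True
    then show ?thesis unfolding mixed.fibre_ring_def
      using mixed.param_poly_fixed[of "[:0, 1:]"] by (intro exI[of _ 2] exI[of _ "\<lambda>a. [:0, 1:]"]) (auto simp: numeral_2_eq_2)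
  next
    case False
    then show ?thesis unfolding mixed.fibre_ring_def
      using mixed.param_poly_const[OF mixed_polyfun.unknown]
      by (intro exI[of _ 1] exI[of _ "\<lambda>a. [:snd a v:]"]) auto
  qed
next
  case (add f g)
  then obtain n p m q where "mixed.param_poly n p" "mixed.param_poly m q"
    "\<forall>a z. f (fst a, (snd a)(w := z)) = poly (p a) z" "\<forall>a z. g (fst a, (snd a)(w := z)) = poly (q a) z"
    unfolding mixed.fibre_ring_def by auto
  then show ?case unfolding mixed.fibre_ring_def
    using mixed.param_poly_add by (intro exI[of _ "max n m"] exI[of _ "\<lambda>a. p a + q a"]) auto
next
  case (mult f g)
  then obtain n p m q where "mixed.param_poly n p" "mixed.param_poly m q"
    "\<forall>a z. f (fst a, (snd a)(w := z)) = poly (p a) z" "\<forall>a z. g (fst a, (snd a)(w := z)) = poly (q a) z"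
    unfolding mixed.fibre_ring_def by auto
  then show ?case unfolding mixed.fibre_ring_def
    using mixed.param_poly_mult by (intro exI[of _ "n + m"] exI[of _ "\<lambda>a. p a * q a"]) auto
qed

text \<open>The unknown is overwritten instead of removed, so the type of the condition stays the
  same and elimination can be iterated.\<close>

lemma mixed_constructible_ex1:
  assumes "mixed_constructible \<phi>"
  shows "mixed_constructible (\<lambda>a. \<exists>z. \<phi> (fst a, (snd a)(w := z)))"
  using mixed.constructible_projection[OF constructible_map[where g = "\<lambda>b. (fst (fst b), (snd (fst b))(w := snd b))",
      OF assms mixed_fibre]] by simp

lemma mixed_constructible_ex:
  assumes "mixed_constructible \<phi>" "finite W"
  shows "mixed_constructible (\<lambda>a. \<exists>y. \<phi> (fst a, override_on (snd a) y W))"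
  using assms(2,1)
proof (induction W rule: finite_induct)
  case empty
  then show ?case by simp
next
  case (insert w W)
  have "(\<exists>z y. \<phi> (fst a, override_on ((snd a)(w := z)) y W))
      \<longleftrightarrow> (\<exists>y. \<phi> (fst a, override_on (snd a) y (insert w W)))" (is "?l \<longleftrightarrow> ?r") for a
  proof
    assume ?l
    then obtain z y where "\<phi> (fst a, override_on ((snd a)(w := z)) y W)" by blast
    moreover have "override_on ((snd a)(w := z)) y W = override_on (snd a) (y(w := z)) (insert w W)"
      using insert.hyps by (auto simp: override_on_def fun_eq_iff)
    ultimately show ?r by auto
  next
    assume ?r
    then obtain y where "\<phi> (fst a, override_on (snd a) y (insert w W))" by blast
    moreover have "override_on ((snd a)(w := y w)) y W = override_on (snd a) y (insert w W)"
      using insert.hyps by (auto simp: override_on_def fun_eq_iff)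
    ultimately show ?l by metis
  qed
  then show ?case
    using mixed_constructible_ex1[OF insert.IH[OF insert.prems], of w] by (simp only: fst_conv snd_conv)
qed

section \<open>Polynomial functions along real lines and generic truth values\<close>

lemma polyfun_diff: "polyfun f \<Longrightarrow> polyfun g \<Longrightarrow> polyfun (\<lambda>x. f x - g x)"
  using polyfun.add[of f "\<lambda>x. (-1) * g x"] polyfun.mult[OF polyfun.const, of g "-1"] by simp

lemma polyfun_on_line:
  "polyfun f \<Longrightarrow> \<exists>q. \<forall>t. f (\<lambda>k. x k + t * d k) = poly q t"
proof (induction rule: polyfun.induct)
  case (const a)
  then show ?case by (intro exI[of _ "[:a:]"]) simp
next
  case (var k)
  then show ?case by (intro exI[of _ "[:x k, d k:]"]) simp
next
  case (add f g)
  then show ?case by (metis poly_add)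
next
  case (mult f g)
  then show ?case by (metis poly_mult)
qed

text \<open>On the line towards \<open>y\<close> the function is a nonzero polynomial in
  \<open>t\<close>, with finitely many roots.\<close>

lemma polyfun_nonzero_near:
  assumes "polyfun f" "f y \<noteq> 0" "e > 0"
  shows "\<exists>t. 0 < t \<and> t < e \<and> f (\<lambda>k. x k + t * (y k - x k)) \<noteq> 0"
proof -
  obtain q where q: "\<And>t. f (\<lambda>k. x k + t * (y k - x k)) = poly q t"
    using polyfun_on_line[OF assms(1), of x "\<lambda>k. y k - x k"] by blast
  have "q \<noteq> 0" using q[of 1] assms(2) by auto
  then have "infinite ({0<..<e} - {t. poly q t = 0})"
    using assms(3) poly_roots_finite[of q] by (simp add: infinite_Ioo)
  then obtain t where "t \<in> {0<..<e} - {t. poly q t = 0}"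
    using infinite_imp_nonempty by blast
  then show ?thesis using q by auto
qed

text \<open>The index type may be infinite; restricting to the line through both points reduces the
  claim to univariate polynomials, which form a domain.\<close>

lemma polyfun_mult_nonzero:
  assumes "polyfun f" "f x \<noteq> 0" "polyfun g" "g y \<noteq> 0"
  shows "\<exists>z. f z * g z \<noteq> 0"
proof -
  obtain q where q: "\<And>t. f (\<lambda>k. x k + t * (y k - x k)) = poly q t"
    using polyfun_on_line[OF assms(1), of x "\<lambda>k. y k - x k"] by blast
  obtain r where r: "\<And>t. g (\<lambda>k. x k + t * (y k - x k)) = poly r t"
    using polyfun_on_line[OF assms(3), of x "\<lambda>k. y k - x k"] by blast
  have "q \<noteq> 0" "r \<noteq> 0" using q[of 0] r[of 1] assms by auto
  then obtain t where "poly (q * r) t \<noteq> 0" using poly_all_0_iff_0 by (metis mult_eq_0_iff)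
  then show ?thesis by (metis poly_mult q r)
qed

lemma mixed_polyfun_Re_Im:
  "mixed_polyfun f \<Longrightarrow> polyfun (\<lambda>x. Re (f (x, y))) \<and> polyfun (\<lambda>x. Im (f (x, y)))"
  by (induction rule: mixed_polyfun.induct) (auto intro!: polyfun.intros polyfun_diff)

text \<open>An atom either holds identically or fails off the zeros of the real polynomial
  \<open>P\<close>, the squared modulus of \<open>f\<close>. A conjunction multiplies the two
  exceptional polynomials.\<close>

theorem constructible_generically_constant:
  "mixed_constructible \<phi> \<Longrightarrow>
    \<exists>P. polyfun P \<and> (\<exists>x. P x \<noteq> 0) \<and> (\<exists>b. \<forall>x. P x \<noteq> 0 \<longrightarrow> \<phi> (x, y) = b)"
proof (induction rule: constructible.induct)
  case (atom f)
  define P where "P x = Re (f (x, y)) * Re (f (x, y)) + Im (f (x, y)) * Im (f (x, y))" for x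
  have P: "polyfun P"
    using mixed_polyfun_Re_Im[OF atom, of y] unfolding P_def by (auto intro!: polyfun.intros)
  have P0: "P x \<noteq> 0 \<longleftrightarrow> f (x, y) \<noteq> 0" for x
    by (simp add: P_def complex_eq_iff sum_squares_eq_zero_iff)
  show ?case
  proof (cases "\<exists>x. P x \<noteq> 0")
    case True
    then show ?thesis using P P0 by blast
  next
    case False
    then show ?thesis using P0 by (intro exI[of _ "\<lambda>x. 1"]) (auto intro: polyfun.const)
  qed
next
  case (neg \<phi>)
  then show ?case by metis
next
  case (conj \<phi> \<psi>)
  obtain P b where P: "polyfun P" "\<exists>x. P x \<noteq> 0" "\<forall>x. P x \<noteq> 0 \<longrightarrow> \<phi> (x, y) = b"
    using conj.IH(1) by blast
  obtain Q c where Q: "polyfun Q" "\<exists>x. Q x \<noteq> 0" "\<forall>x. Q x \<noteq> 0 \<longrightarrow> \<psi> (x, y) = c"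
    using conj.IH(2) by blast
  show ?case
    using P Q polyfun_mult_nonzero[of P _ Q]
    by (intro exI[of _ "\<lambda>x. P x * Q x"] conjI exI[of _ "b \<and> c"] polyfun.mult) auto
qed

subsection \<open>Lines and normalized solutions\<close>

lemma bounded_bilinear_cdot: "bounded_bilinear (cdot :: complex^'n \<Rightarrow> complex^'n \<Rightarrow> complex)"
proof
  show "cdot (x + y) z = cdot x z + cdot y z" "cdot x (y + z) = cdot x y + cdot x z"
    "cdot (t *\<^sub>R x) y = t *\<^sub>R cdot x y" "cdot x (t *\<^sub>R y) = t *\<^sub>R cdot x y"
    for x y z :: "complex^'n" and t
    by (simp_all add: cdot_def algebra_simps sum.distrib scaleR_sum_right)
  have "norm (cdot x y) \<le> norm x * norm y * real CARD('n)" for x y :: "complex^'n"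
  proof -
    have "norm (cdot x y) \<le> (\<Sum>i\<in>(UNIV::'n set). norm x * norm y)"
      unfolding cdot_def
      by (intro sum_norm_le) (simp add: norm_mult mult_mono Finite_Cartesian_Product.norm_nth_le)
    then show ?thesis by (simp add: mult_ac)
  qed
  then show "\<exists>K. \<forall>x y :: complex^'n. norm (cdot x y) \<le> norm x * norm y * K" by blast
qed

interpretation cdot: bounded_bilinear "cdot :: complex^'n \<Rightarrow> complex^'n \<Rightarrow> complex"
  by (rule bounded_bilinear_cdot)

lemma cdot_commute: "cdot x y = cdot y x"
  by (simp add: cdot_def mult.commute)

lemma cdot_vector_smult [simp]: "cdot (s *s x) y = s * cdot x y" "cdot x (s *s y) = s * cdot x y"
  by (simp_all add: cdot_def sum_distrib_left mult_ac)

lemma line_of_altdef: "line_of p v = {p + t *s v | t. True}"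
  by (simp add: line_of_def vec_eq_iff vector_scalar_mult_def plus_vec_def)

lemma line_of_eqD:
  assumes "line_of p v = line_of q w"
  shows "\<exists>s t. q = p + t *s v \<and> w = s *s v"
proof -
  have "\<exists>t. q = q + t *s w" by (intro exI[of _ 0]) simp
  moreover have "\<exists>t. q + w = q + t *s w" by (intro exI[of _ 1]) simp
  ultimately have "q \<in> line_of p v" "q + w \<in> line_of p v"
    unfolding assms unfolding line_of_altdef by simp_all
  then obtain t t' where t: "q = p + t *s v" "q + w = p + t' *s v"
    unfolding line_of_altdef by blast
  then have "w = (t' - t) *s v"
    by (metis add_diff_cancel_left add_diff_cancel_left' vector_sub_rdistrib)
  then show ?thesis using t(1) by blast
qed

lemma line_of_smult:
  assumes "s \<noteq> 0"
  shows "line_of p (s *s v) = line_of p v"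
proof -
  have "\<exists>t'. t = t' * s" for t using assms by (intro exI[of _ "t / s"]) simp
  then show ?thesis unfolding line_of_altdef by (auto simp: vector_smult_assoc)
qed

lemma line_of_shift: "line_of (p + t *s v) v = line_of p v"
proof -
  have "p + t' *s v = p + t *s v + (t' - t) *s v" for t'
    by (simp add: vector_sub_rdistrib)
  moreover have "p + t *s v + t' *s v = p + (t + t') *s v" for t'
    by (simp add: vector_sadd_rdistrib)
  ultimately show ?thesis unfolding line_of_altdef by (intro Collect_cong) metis
qed

lemma tangent_eq_smult:
  assumes "s \<noteq> 0"
  shows "tangent_eq p (s *s v) c r \<longleftrightarrow> tangent_eq p v c r"
proof -
  have "cdot (s *s v) (s *s v) * cdot p p - 2 * cdot (s *s v) (s *s v) * cdot p c +
      cdot (s *s v) (s *s v) * cdot c c - (cdot (s *s v) c)\<^sup>2 - r\<^sup>2 * cdot (s *s v) (s *s v) =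
    s\<^sup>2 * (cdot v v * cdot p p - 2 * cdot v v * cdot p c + cdot v v * cdot c c
       - (cdot v c)\<^sup>2 - r\<^sup>2 * cdot v v)"
    by (simp add: algebra_simps power2_eq_square)
  then show ?thesis using assms unfolding tangent_eq_def by simp
qed

definition normal_sols ::
  "nat \<Rightarrow> (nat \<Rightarrow> real^'n) \<Rightarrow> (nat \<Rightarrow> real) \<Rightarrow> ((complex^'n) \<times> (complex^'n)) set" where
  "normal_sols m c r = {(p, v). cdot v v = 1 \<and> cdot p v = 0 \<and>
     (\<forall>i<m. tangent_eq p v (cvec (c i)) (complex_of_real (r i)))}"

definition spanning :: "nat \<Rightarrow> (nat \<Rightarrow> real^'n) \<Rightarrow> bool" where
  "spanning m c \<longleftrightarrow> (\<forall>v. (\<forall>i<m. cdot v (cvec (c i)) = 0) \<longrightarrow> v = 0)"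

text \<open>An isotropic direction would be orthogonal to every center by the tangency equations,
  which spanning forbids. Any other direction can be scaled to \<open>cdot v v = 1\<close> and
  determines the foot point of the line, so the representatives belonging to different spheres
  coincide.\<close>

lemma common_tangents_eq_image:
  assumes "spanning m c"
  shows "common_tangents m c r = (\<lambda>(p, v). line_of p v) ` normal_sols m c r"
proof (intro equalityI subsetI)
  fix L assume "L \<in> common_tangents m c r"
  then have L: "is_cline L" "\<And>i. i < m \<Longrightarrow> tangent_line L (c i) (r i)"
    by (simp_all add: common_tangents_def)
  obtain p v where pv: "v \<noteq> 0" "L = line_of p v"
    using L(1) unfolding is_cline_def by (elim exE conjE)
  \<comment> \<open>\<open>tangent_line\<close> picks a representative for each sphere separately;
    here all of them get the direction \<open>v\<close>, with the foot still depending on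
    \<open>i\<close>.\<close>
  have rep: "\<exists>q. line_of q v = L \<and> cdot q v = 0 \<and>
      tangent_eq q v (cvec (c i)) (complex_of_real (r i))" if "i < m" for i
  proof -
    obtain q w where q: "w \<noteq> 0" "L = line_of q w" "cdot q w = 0"
        "tangent_eq q w (cvec (c i)) (complex_of_real (r i))"
      using L(2)[OF \<open>i < m\<close>] unfolding tangent_line_def by (elim exE conjE)
    obtain s where s: "w = s *s v" using line_of_eqD[of p v q w] pv(2) q(2) by auto
    then have "s \<noteq> 0" using q(1) by auto
    have "line_of q v = L" using q(2) s \<open>s \<noteq> 0\<close> by (simp add: line_of_smult)
    moreover have "cdot q v = 0" using q(3) s \<open>s \<noteq> 0\<close> by simp
    moreover have "tangent_eq q v (cvec (c i)) (complex_of_real (r i))"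
      using q(4) s \<open>s \<noteq> 0\<close> by (simp add: tangent_eq_smult)
    ultimately show ?thesis by (intro exI[of _ q] conjI)
  qed
  have "cdot v v \<noteq> 0"
  proof
    assume "cdot v v = 0"
    have "cdot v (cvec (c i)) = 0" if i: "i < m" for i
    proof -
      obtain q where "tangent_eq q v (cvec (c i)) (complex_of_real (r i))" using rep[OF i] by (elim exE conjE)
      then show ?thesis by (simp add: tangent_eq_def \<open>cdot v v = 0\<close>)
    qed
    then show False using assms pv(1) by (simp add: spanning_def)
  qed
  define s where "s = 1 / csqrt (cdot v v)"
  define u where "u = s *s v"
  have s: "s \<noteq> 0" "s\<^sup>2 * cdot v v = 1"
    using \<open>cdot v v \<noteq> 0\<close> by (simp_all add: s_def power_divide)
  define q where "q = p + (- cdot p v / cdot v v) *s v"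
  have q: "cdot q v = 0"
    using \<open>cdot v v \<noteq> 0\<close> by (simp add: q_def cdot.diff_left cdot.add_left)
  have Lq: "line_of q u = L"
    unfolding u_def line_of_smult[OF s(1)] q_def line_of_shift pv(2) ..
  have "tangent_eq q u (cvec (c i)) (complex_of_real (r i))" if "i < m" for i
  proof -
    obtain q' where q': "line_of q' v = L" "cdot q' v = 0"
        "tangent_eq q' v (cvec (c i)) (complex_of_real (r i))"
      using rep[OF \<open>i < m\<close>] by (elim exE conjE)
    have "line_of q v = line_of q' v" using Lq q' s(1) by (simp add: u_def line_of_smult)
    then obtain t where "q' = q + t *s v" using line_of_eqD by blast
    moreover from this have "t = 0"
      using q q'(2) \<open>cdot v v \<noteq> 0\<close> by (simp add: cdot.add_left)
    ultimately have "q' = q" by simp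
    then show ?thesis using q'(3) s(1) by (simp add: u_def tangent_eq_smult)
  qed
  then have "(q, u) \<in> normal_sols m c r"
    using s q by (simp add: normal_sols_def u_def power2_eq_square mult_ac)
  from this Lq show "L \<in> (\<lambda>(p, v). line_of p v) ` normal_sols m c r"
    by (intro image_eqI[of _ _ "(q, u)"]) simp_all
next
  fix L assume "L \<in> (\<lambda>(p, v). line_of p v) ` normal_sols m c r"
  then obtain p v where "(p, v) \<in> normal_sols m c r" "L = line_of p v" by auto
  moreover from this have "v \<noteq> 0" by (auto simp: normal_sols_def cdot.zero_left)
  ultimately show "L \<in> common_tangents m c r"
    unfolding common_tangents_def is_cline_def tangent_line_def normal_sols_def by auto
qed

lemma normal_sols_fibre:
  assumes "(p, v) \<in> normal_sols m c r"
  shows "{x \<in> normal_sols m c r. (\<lambda>(p, v). line_of p v) x = line_of p v} = {(p, v), (p, - v)}"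
proof (intro equalityI subsetI)
  fix x assume "x \<in> {x \<in> normal_sols m c r. (\<lambda>(p, v). line_of p v) x = line_of p v}"
  then obtain q w where x: "x = (q, w)" "(q, w) \<in> normal_sols m c r" "line_of p v = line_of q w"
    by (cases x) auto
  then obtain s t where st: "q = p + t *s v" "w = s *s v" using line_of_eqD by blast
  have *: "cdot v v = 1" "cdot p v = 0" "cdot w w = 1" "cdot q w = 0"
    using assms x(2) by (auto simp: normal_sols_def)
  then have "s * s = 1" by (simp add: st)
  then have "s = 1 \<or> s = -1" by (simp add: square_eq_1_iff)
  moreover have "t = 0"
    using * \<open>s * s = 1\<close> by (auto simp: st cdot.add_left)
  ultimately show "x \<in> {(p, v), (p, - v)}"
    by (auto simp: x st vec_eq_iff)
next
  fix x assume "x \<in> {(p, v), (p, - v)}"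
  then have "x = (p, v) \<or> x = (p, (-1) *s v)" by (auto simp: vec_eq_iff)
  then show "x \<in> {x \<in> normal_sols m c r. (\<lambda>(p, v). line_of p v) x = line_of p v}"
    using assms line_of_smult[of "-1" p v] tangent_eq_smult[of "-1" p v]
    by (auto simp: normal_sols_def cdot.minus_left cdot.minus_right)
qed

lemma card_common_tangents:
  assumes "spanning m c" "finite (normal_sols m c r)"
  shows "finite (common_tangents m c r)"
    and "card (normal_sols m c r) = 2 * card (common_tangents m c r)"
proof -
  let ?S = "normal_sols m c r" and ?f = "\<lambda>(p, v). line_of p v"
  show fin: "finite (common_tangents m c r)"
    using assms by (simp add: common_tangents_eq_image)
  have "card ?S = (\<Sum>L\<in>?f ` ?S. card {x \<in> ?S. ?f x = L})"
    using sum.image_gen[OF assms(2), of "\<lambda>x. 1::nat" ?f] by simp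
  also have "\<dots> = (\<Sum>L\<in>?f ` ?S. 2)"
  proof (rule sum.cong)
    fix L assume "L \<in> ?f ` ?S"
    then obtain p v where pv: "(p, v) \<in> ?S" "L = line_of p v" by auto
    have "v \<noteq> - v"
    proof
      assume "v = - v"
      then have "v = 0" by (simp add: vec_eq_iff)
      then show False using pv(1) by (auto simp: normal_sols_def cdot.zero_left)
    qed
    then show "card {x \<in> ?S. ?f x = L} = 2"
      unfolding pv(2) normal_sols_fibre[OF pv(1)] by simp
  qed simp
  finally show "card ?S = 2 * card (common_tangents m c r)"
    using assms by (simp add: common_tangents_eq_image)
qed

subsection \<open>Four spheres at a regular tetrahedron and \<open>2(n-3)\<close> spheres on the other axes\<close>

text \<open>The sign patterns of the vertices satisfy \<open>s1 * s2 = s3\<close> and form a group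
  of order four with characters \<open>1\<close>, \<open>s1\<close>, \<open>s2\<close>,
  \<open>s3\<close>. A product of two linear forms reduces to these four, the coefficient at
  \<open>s1\<close> being \<open>u2 * w3 + u3 * w2\<close>, and orthogonality of characters
  separates the coefficients.\<close>

lemma tetrahedron_equations:
  fixes \<kappa> :: complex
  assumes "\<kappa> = (q1 + q2 + q3) + (u1 + u2 + u3) * (w1 + w2 + w3)"
    and "\<kappa> = (q1 - q2 - q3) + (u1 - u2 - u3) * (w1 - w2 - w3)"
    and "\<kappa> = (- q1 + q2 - q3) + (- u1 + u2 - u3) * (- w1 + w2 - w3)"
    and "\<kappa> = (- q1 - q2 + q3) + (- u1 - u2 + u3) * (- w1 - w2 + w3)"
  shows "q1 = - (u2 * w3 + u3 * w2)" "q2 = - (u1 * w3 + u3 * w1)" "q3 = - (u1 * w2 + u2 * w1)"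
    "\<kappa> = u1 * w1 + u2 * w2 + u3 * w3"
proof -
  have "4 * (q1 + (u2 * w3 + u3 * w2)) = 0" "4 * (q2 + (u1 * w3 + u3 * w1)) = 0"
       "4 * (q3 + (u1 * w2 + u2 * w1)) = 0" "4 * (\<kappa> - (u1 * w1 + u2 * w2 + u3 * w3)) = 0"
    using assms by algebra+
  then have "q1 + (u2 * w3 + u3 * w2) = 0" "q2 + (u1 * w3 + u3 * w1) = 0"
       "q3 + (u1 * w2 + u2 * w1) = 0" "\<kappa> - (u1 * w1 + u2 * w2 + u3 * w3) = 0"
    by (simp_all only: mult_eq_0_iff zero_neq_numeral[symmetric] simp_thms)
  then show "q1 = - (u2 * w3 + u3 * w2)" "q2 = - (u1 * w3 + u3 * w1)" "q3 = - (u1 * w2 + u2 * w1)"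
    "\<kappa> = u1 * w1 + u2 * w2 + u3 * w3"
    by (simp_all only: eq_neg_iff_add_eq_0 right_minus_eq)
qed

text \<open>The linear and the quadratic part are odd and even in \<open>a\<close>, so opposite
  centers separate them.\<close>

lemma axis_equations:
  fixes \<kappa> :: complex
  assumes "\<kappa> = a * q + (a * u) * (a * w)" "\<kappa> = - a * q + (- a * u) * (- a * w)" "a \<noteq> 0"
  shows "q = 0" "\<kappa> = a\<^sup>2 * (u * w)"
proof -
  have "2 * (a * q) = 0" using assms(1,2) by algebra
  then show "q = 0" using assms(3) by simp
  then show "\<kappa> = a\<^sup>2 * (u * w)" using assms(1) by (simp add: power2_eq_square)
qed

text \<open>Vieta: the three numbers have the elementary symmetric functions of \<open>0\<close>,
  \<open>X\<close>, \<open>Y\<close>.\<close>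

lemma two_of_three:
  fixes b1 b2 b3 X Y :: complex
  assumes "b1 * b2 * b3 = 0" "b1 + b2 + b3 = X + Y" "b1 * b2 + b1 * b3 + b2 * b3 = X * Y"
  shows "(b1, b2, b3) \<in> {(0, X, Y), (0, Y, X), (X, 0, Y), (Y, 0, X), (X, Y, 0), (Y, X, 0)}"
proof -
  have *: "(b = X \<and> b' = Y) \<or> (b = Y \<and> b' = X)" if "b + b' = X + Y" "b * b' = X * Y" for b b'
  proof -
    have "(b - X) * (b - Y) = 0" using that by algebra
    then show ?thesis using that by auto
  qed
  consider "b1 = 0" | "b2 = 0" | "b3 = 0" using assms(1) by auto
  then show ?thesis
  proof cases
    case 1
    then show ?thesis using *[of b2 b3] assms by auto
  next
    case 2
    then show ?thesis using *[of b1 b3] assms by auto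
  next
    case 3
    then show ?thesis using *[of b1 b2] assms by auto
  qed
qed

lemma card_square_roots: "card {z::complex. z\<^sup>2 = s} = (if s = 0 then 1 else 2)"
proof -
  have "{z. z\<^sup>2 = s} = {csqrt s, - csqrt s}"
    using power2_csqrt[of s] by (auto simp: power2_eq_iff) (metis power2_csqrt power2_eq_iff)+
  then show ?thesis by auto
qed

lemma card_vec_box:
  "card {v :: 'a^'n::finite. \<forall>k. v $ k \<in> A k} = (\<Prod>k\<in>UNIV. card (A k))"
proof -
  have "bij_betw (\<lambda>v. vec_nth v) {v :: 'a^'n. \<forall>k. v $ k \<in> A k} (PiE UNIV A)"
    by (rule bij_betw_byWitness[where f' = vec_lambda]) auto
  then show ?thesis by (simp add: bij_betw_same_card card_PiE)
qed

text \<open>The parameters are the values forced on a solution: \<open>v\<^sub>j\<^sup>2 = w\<close> for \<open>j \<in> J\<close>, and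
  \<open>{v\<^sub>i\<^sup>2 | i \<notin> J} = {0, X, Y}\<close>. The last three assumptions express \<open>v\<^sup>2 = 1\<close> and the tangent
  equations at \<open>\<plusminus>a e\<^sub>j\<close> and at the tetrahedron.\<close>

locale tetra_config =
  fixes i1 i2 i3 :: "'n::finite" and J :: "'n set" and a w X Y r :: real
  assumes distinct: "i1 \<noteq> i2" "i1 \<noteq> i3" "i2 \<noteq> i3"
    and J_def: "J = UNIV - {i1, i2, i3}"
    and pos: "a > 0" "w > 0" "X > 0" "Y > 0" "r > 0"
    and XY: "X \<noteq> Y"
    and sum_squares: "X + Y + real (card J) * w = 1"
    and w_eq: "a\<^sup>2 * w = X + Y - 3 + a\<^sup>2"
    and r_eq: "r\<^sup>2 = 3 - (X + Y) + X * Y"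
begin

definition tri :: "'a::zero \<Rightarrow> 'a \<Rightarrow> 'a \<Rightarrow> 'a^'n" where
  "tri s1 s2 s3 = (\<chi> k. if k = i1 then s1 else if k = i2 then s2 else if k = i3 then s3 else 0)"

definition centers :: "(real^'n) set" where
  "centers = {tri 1 1 1, tri 1 (-1) (-1), tri (-1) 1 (-1), tri (-1) (-1) 1} \<union>
     (\<lambda>j. axis j a) ` J \<union> (\<lambda>j. axis j (- a)) ` J"

lemma J_simps [simp]: "i1 \<notin> J" "i2 \<notin> J" "i3 \<notin> J" "finite J"
  by (auto simp: J_def)

lemma tri_simps [simp]: "tri s1 s2 s3 $ i1 = s1" "tri s1 s2 s3 $ i2 = s2" "tri s1 s2 s3 $ i3 = s3"
  "j \<in> J \<Longrightarrow> tri s1 s2 s3 $ j = 0"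
  using distinct by (auto simp: tri_def)

lemma UNIV_eq: "UNIV = insert i1 (insert i2 (insert i3 J))"
  by (auto simp: J_def)

lemma cdot_split: "cdot x y = x$i1 * y$i1 + x$i2 * y$i2 + x$i3 * y$i3 + (\<Sum>j\<in>J. x$j * y$j)"
  unfolding cdot_def UNIV_eq using distinct by (simp add: add_ac)

lemma cvec_nth [simp]: "cvec x $ k = complex_of_real (x $ k)"
  by (simp add: cvec_def)

lemma cdot_tri [simp]:
  "cdot x (cvec (tri s1 s2 s3)) = x$i1 * of_real s1 + x$i2 * of_real s2 + x$i3 * of_real s3"
  by (simp add: cdot_split)

lemma cdot_axis [simp]:
  fixes x :: "complex^'n"
  shows "cdot x (cvec (axis j s)) = x$j * of_real s"
  by (simp add: cdot_def axis_def if_distrib[of "\<lambda>b. _ * b"] if_distrib[of complex_of_real] cong: if_cong)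

lemma ball_centers: "(\<forall>c\<in>centers. P c) \<longleftrightarrow> P (tri 1 1 1) \<and> P (tri 1 (-1) (-1)) \<and>
    P (tri (-1) 1 (-1)) \<and> P (tri (-1) (-1) 1) \<and> (\<forall>j\<in>J. P (axis j a) \<and> P (axis j (- a)))"
  by (auto simp: centers_def)

lemma all_split: "(\<forall>k. P k) \<longleftrightarrow> P i1 \<and> P i2 \<and> P i3 \<and> (\<forall>j\<in>J. P j)"
  using UNIV_eq by (metis UNIV_I insertE)

lemma vec_eq_iff_split: "(x :: 'b^'n) = y \<longleftrightarrow> x$i1 = y$i1 \<and> x$i2 = y$i2 \<and> x$i3 = y$i3 \<and> (\<forall>j\<in>J. x$j = y$j)"
  unfolding vec_eq_iff by (rule all_split)

text \<open>The equation \<open>\<kappa> + h(c\<^sup>2) = q \<cdot> c + (u \<cdot> c)(z \<cdot> c)\<close> occurs for the tangent lines, for the kernel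
  of their Jacobian and for the solutions at infinity; \<open>h\<close> is the identity in the first case and
  \<open>0\<close> in the others.\<close>

lemma center_equations_solve:
  fixes q u z :: "complex^'n"
  assumes "\<forall>c\<in>centers. \<kappa> + h (cdot (cvec c) (cvec c)) = cdot q (cvec c) + cdot u (cvec c) * cdot z (cvec c)"
  shows "q$i1 = - (u$i2 * z$i3 + u$i3 * z$i2)" "q$i2 = - (u$i1 * z$i3 + u$i3 * z$i1)"
    "q$i3 = - (u$i1 * z$i2 + u$i2 * z$i1)" "\<kappa> + h 3 = u$i1 * z$i1 + u$i2 * z$i2 + u$i3 * z$i3"
    and "\<And>j. j \<in> J \<Longrightarrow> q$j = 0" "\<And>j. j \<in> J \<Longrightarrow> \<kappa> + h (of_real (a\<^sup>2)) = of_real (a\<^sup>2) * (u$j * z$j)"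
proof -
  note E = assms[unfolded ball_centers]
  have T: "\<kappa> + h 3 = (q$i1 + q$i2 + q$i3) + (u$i1 + u$i2 + u$i3) * (z$i1 + z$i2 + z$i3)"
    "\<kappa> + h 3 = (q$i1 - q$i2 - q$i3) + (u$i1 - u$i2 - u$i3) * (z$i1 - z$i2 - z$i3)"
    "\<kappa> + h 3 = (- q$i1 + q$i2 - q$i3) + (- u$i1 + u$i2 - u$i3) * (- z$i1 + z$i2 - z$i3)"
    "\<kappa> + h 3 = (- q$i1 - q$i2 + q$i3) + (- u$i1 - u$i2 + u$i3) * (- z$i1 - z$i2 + z$i3)"
    using E by auto
  show "q$i1 = - (u$i2 * z$i3 + u$i3 * z$i2)" "q$i2 = - (u$i1 * z$i3 + u$i3 * z$i1)"
    "q$i3 = - (u$i1 * z$i2 + u$i2 * z$i1)" "\<kappa> + h 3 = u$i1 * z$i1 + u$i2 * z$i2 + u$i3 * z$i3"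
    by (rule tetrahedron_equations[OF T])+
  fix j assume "j \<in> J"
  then have 1: "\<kappa> + h (of_real (a\<^sup>2)) = of_real a * q$j + (of_real a * u$j) * (of_real a * z$j)"
    and 2: "\<kappa> + h (of_real (a\<^sup>2)) = - of_real a * q$j + (- of_real a * u$j) * (- of_real a * z$j)"
    using E by (auto simp: axis_nth power2_eq_square mult_ac)
  have "complex_of_real a \<noteq> 0" using pos by simp
  from axis_equations[OF 1 2 this]
  show "q$j = 0" "\<kappa> + h (of_real (a\<^sup>2)) = of_real (a\<^sup>2) * (u$j * z$j)" by simp_all
qed

text \<open>The coefficient \<open>a^2 + card J\<close> is positive. This pins down the sum of the
  first three squares of a solution, and makes \<open>\<kappa>\<close> vanish in the Jacobian kernel
  and at infinity.\<close>

lemma linear_equation_unique: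
  assumes "of_real (a\<^sup>2) * (S - T) = - of_nat (card J) * (S - T :: complex)"
  shows "S = T"
proof -
  have "(of_real (a\<^sup>2) + of_nat (card J)) * (S - T) = 0" using assms by algebra
  moreover have "of_real (a\<^sup>2) + of_nat (card J) = complex_of_real (a\<^sup>2 + real (card J))" by simp
  moreover have "a\<^sup>2 + real (card J) > 0" using pos by (simp add: add_pos_nonneg)
  ultimately show ?thesis by (metis mult_eq_0_iff of_real_eq_0_iff less_irrefl right_minus_eq)
qed

definition square_patterns :: "('n \<Rightarrow> real) set" where
  "square_patterns = (\<lambda>(b1, b2, b3). vec_nth (tri b1 b2 b3 + (\<chi> k. if k \<in> J then w else 0))) `
     {(0, X, Y), (0, Y, X), (X, 0, Y), (Y, 0, X), (X, Y, 0), (Y, X, 0)}"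

definition directions :: "(complex^'n) set" where
  "directions = (\<Union>s\<in>square_patterns. {v. \<forall>k. v $ k \<in> {z. z\<^sup>2 = of_real (s k)}})"

definition foot :: "complex^'n \<Rightarrow> complex^'n" where
  "foot v = tri (- (v$i2 * v$i3)) (- (v$i1 * v$i3)) (- (v$i1 * v$i2))"

definition config_sols :: "((complex^'n) \<times> (complex^'n)) set" where
  "config_sols = {(p, v). cdot v v = 1 \<and> cdot p v = 0 \<and> (\<forall>c\<in>centers. tangent_eq p v (cvec c) (of_real r))}"

lemma directions_iff: "v \<in> directions \<longleftrightarrow> ((v$i1)\<^sup>2, (v$i2)\<^sup>2, (v$i3)\<^sup>2) \<in>
    {(0, of_real X, of_real Y), (0, of_real Y, of_real X), (of_real X, 0, of_real Y),
     (of_real Y, 0, of_real X), (of_real X, of_real Y, 0), (of_real Y, of_real X, 0)} \<and>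
    (\<forall>j\<in>J. (v$j)\<^sup>2 = of_real w)"
  unfolding directions_def square_patterns_def by (auto simp: all_split)

text \<open>The vertex equations force \<open>p = foot v\<close>. Then \<open>cdot p v\<close> is
  \<open>-3\<close> times the product of the three tetrahedral coordinates of \<open>v\<close>, and
  \<open>cdot p p\<close> is the second symmetric function of their squares. The sum of these
  squares is fixed by the axis equations and \<open>cdot v v = 1\<close>, and
  \<open>cdot p p\<close> by the radius, so all their symmetric functions are known.\<close>

lemma config_sols_eq: "config_sols = (\<lambda>v. (foot v, v)) ` directions"
proof (intro equalityI subsetI)
  fix x assume "x \<in> config_sols"
  then obtain p v where x: "x = (p, v)" and vv: "cdot v v = 1" and pv: "cdot p v = 0"
    and T: "\<And>c. c \<in> centers \<Longrightarrow> tangent_eq p v (cvec c) (of_real r)"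
    by (auto simp: config_sols_def)
  have "\<forall>c\<in>centers. (cdot p p - of_real (r\<^sup>2)) + cdot (cvec c) (cvec c) = cdot (2 *s p) (cvec c) + cdot v (cvec c) * cdot v (cvec c)"
  proof
    fix c assume "c \<in> centers"
    from T[OF this] show "(cdot p p - of_real (r\<^sup>2)) + cdot (cvec c) (cvec c) = cdot (2 *s p) (cvec c) + cdot v (cvec c) * cdot v (cvec c)"
      by (simp add: tangent_eq_def vv) algebra
  qed
  note E = center_equations_solve[where h = "\<lambda>x. x", OF this]
  have p: "p$i1 = - (v$i2 * v$i3)" "p$i2 = - (v$i1 * v$i3)" "p$i3 = - (v$i1 * v$i2)" "\<forall>j\<in>J. p$j = 0"
    using E(1-3,5) by (auto simp: mult.commute)
  then have "p = foot v" by (simp add: vec_eq_iff_split foot_def)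
  \<comment> \<open>Both the actual sum of squares and \<open>X + Y\<close> satisfy one affine
    equation; subtracting gives its homogeneous form.\<close>
  have difference: "A * (S - T) = - N * (S - T)"
    if "A * (1 - S) = N * (S - 3 + A)" "A * (1 - T) = N * (T - 3 + A)" for A N S T :: complex
  proof -
    have "A * (S - T) = A * (1 - T) - A * (1 - S)" by (simp add: algebra_simps)
    also have "\<dots> = N * (T - 3 + A) - N * (S - 3 + A)" by (simp only: that)
    finally show ?thesis by (simp add: algebra_simps)
  qed
  define S where "S = (v$i1)\<^sup>2 + (v$i2)\<^sup>2 + (v$i3)\<^sup>2"
  have S: "S = cdot p p - of_real (r\<^sup>2) + 3" using E(4) by (simp add: S_def power2_eq_square)
  have Jv: "of_real (a\<^sup>2) * (v$j)\<^sup>2 = S - 3 + of_real (a\<^sup>2)" if "j \<in> J" for j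
    using E(6)[OF that] by (simp add: S power2_eq_square)
  have "S + (\<Sum>j\<in>J. (v$j)\<^sup>2) = 1"
    using vv by (simp add: S_def cdot_split power2_eq_square)
  moreover have "of_real (a\<^sup>2) * (\<Sum>j\<in>J. (v$j)\<^sup>2) = of_nat (card J) * (S - 3 + of_real (a\<^sup>2))"
    using Jv by (simp add: sum_distrib_left)
  ultimately have "of_real (a\<^sup>2) * (1 - S) = of_nat (card J) * (S - 3 + of_real (a\<^sup>2))"
    by (metis add_diff_cancel_left')
  moreover have "of_real (a\<^sup>2) * (1 - complex_of_real (X + Y)) = of_nat (card J) * (of_real (X + Y) - 3 + of_real (a\<^sup>2))"
  proof -
    have "a\<^sup>2 * (1 - (X + Y)) = real (card J) * (X + Y - 3 + a\<^sup>2)"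
    proof -
      have "1 - (X + Y) = real (card J) * w" using sum_squares by simp
      then have "a\<^sup>2 * (1 - (X + Y)) = real (card J) * (a\<^sup>2 * w)" by simp
      then show ?thesis by (simp only: w_eq)
    qed
    from arg_cong[OF this, of complex_of_real] show ?thesis
      by (simp only: of_real_1 of_real_add of_real_diff of_real_mult of_real_numeral of_real_of_nat_eq)
  qed
  ultimately have SXY: "S = of_real (X + Y)"
    by (rule linear_equation_unique[OF difference])
  have vw: "(v$j)\<^sup>2 = of_real w" if "j \<in> J" for j
  proof -
    have "of_real (a\<^sup>2) * (v$j)\<^sup>2 = complex_of_real (a\<^sup>2 * w)"
      using Jv[OF that] by (simp only: SXY w_eq) simp
    then show ?thesis using pos by simp
  qed
  have "v$i1 * v$i2 * v$i3 = 0"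
  proof -
    have "cdot p v = -3 * (v$i1 * v$i2 * v$i3)" using p by (simp add: cdot_split)
    then show ?thesis using pv by simp
  qed
  then have 1: "(v$i1)\<^sup>2 * (v$i2)\<^sup>2 * (v$i3)\<^sup>2 = 0" by auto
  have 2: "(v$i1)\<^sup>2 + (v$i2)\<^sup>2 + (v$i3)\<^sup>2 = of_real X + of_real Y"
    using SXY by (simp add: S_def)
  have "cdot p p = (v$i1)\<^sup>2 * (v$i2)\<^sup>2 + (v$i1)\<^sup>2 * (v$i3)\<^sup>2 + (v$i2)\<^sup>2 * (v$i3)\<^sup>2"
    using p by (simp add: cdot_split power2_eq_square)
  moreover have "cdot p p = of_real (X * Y)"
    using S by (simp add: SXY r_eq)
  ultimately have 3: "(v$i1)\<^sup>2 * (v$i2)\<^sup>2 + (v$i1)\<^sup>2 * (v$i3)\<^sup>2 + (v$i2)\<^sup>2 * (v$i3)\<^sup>2 = of_real X * of_real Y"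
    by simp
  have "v \<in> directions"
    unfolding directions_iff using two_of_three[OF 1 2 3] vw by blast
  then show "x \<in> (\<lambda>v. (foot v, v)) ` directions" using x \<open>p = foot v\<close> by blast
next
  fix x assume "x \<in> (\<lambda>v. (foot v, v)) ` directions"
  then obtain v where x: "x = (foot v, v)" and "v \<in> directions" by blast
  then have sq: "((v$i1)\<^sup>2, (v$i2)\<^sup>2, (v$i3)\<^sup>2) \<in>
    {(0, of_real X, of_real Y), (0, of_real Y, of_real X), (of_real X, 0, of_real Y),
     (of_real Y, 0, of_real X), (of_real X, of_real Y, 0), (of_real Y, of_real X, 0)}"
    and vw: "\<And>j. j \<in> J \<Longrightarrow> (v$j)\<^sup>2 = of_real w"
    unfolding directions_iff by blast+
  have 1: "v$i1 * v$i2 * v$i3 = 0" and 2: "(v$i1)\<^sup>2 + (v$i2)\<^sup>2 + (v$i3)\<^sup>2 = of_real X + of_real Y"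
    and 3: "(v$i1)\<^sup>2 * (v$i2)\<^sup>2 + (v$i1)\<^sup>2 * (v$i3)\<^sup>2 + (v$i2)\<^sup>2 * (v$i3)\<^sup>2 = of_real X * of_real Y"
    using sq by auto
  have f: "foot v $ i1 = - (v$i2 * v$i3)" "foot v $ i2 = - (v$i1 * v$i3)" "foot v $ i3 = - (v$i1 * v$i2)"
    "\<And>j. j \<in> J \<Longrightarrow> foot v $ j = 0" by (simp_all add: foot_def)
  have "cdot v v = complex_of_real (X + Y + real (card J) * w)"
    using 2 vw by (simp add: cdot_split flip: power2_eq_square)
  then have vv: "cdot v v = 1" by (simp add: sum_squares)
  have pv: "cdot (foot v) v = 0" using 1 by (simp add: cdot_split f)
  have ff: "cdot (foot v) (foot v) = of_real (X * Y)"
    using 3 by (simp add: cdot_split f power2_eq_square algebra_simps)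
  have r: "complex_of_real r ^ 2 = 3 - (of_real X + of_real Y) + of_real X * of_real Y"
    using arg_cong[OF r_eq, of complex_of_real]
    by (simp only: of_real_add of_real_diff of_real_mult of_real_numeral of_real_power)
  have aw: "of_real w * (complex_of_real a)\<^sup>2 = of_real X + of_real Y - 3 + (of_real a)\<^sup>2"
    using arg_cong[OF w_eq, of complex_of_real]
    by (simp only: of_real_add of_real_diff of_real_mult of_real_numeral of_real_power mult.commute)
  have "\<forall>c\<in>centers. tangent_eq (foot v) v (cvec c) (of_real r)"
    unfolding ball_centers tangent_eq_def vv ff
    using 2 by (auto simp: f r vw power_mult_distrib aw axis_nth) (simp_all add: algebra_simps power2_eq_square)
  then show "x \<in> config_sols" using vv pv by (simp add: config_sols_def x)
qed

text \<open>Six arrangements of the distinct values \<open>0\<close>, \<open>X\<close>,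
  \<open>Y\<close>; in each, one coordinate vanishes and every other one has two possible
  signs.\<close>

lemma card_directions: "card directions = 6 * 2 ^ (CARD('n) - 1)" "finite directions"
proof -
  let ?V = "\<lambda>s. {v :: complex^'n. \<forall>k. v $ k \<in> {z. z\<^sup>2 = of_real (s k)}}"
  have fin: "finite square_patterns" by (simp add: square_patterns_def)
  have cardV: "card (?V s) = 2 ^ (CARD('n) - 1)" if s: "s \<in> square_patterns" for s
  proof -
    obtain b where b: "b \<in> {(0, X, Y), (0, Y, X), (X, 0, Y), (Y, 0, X), (X, Y, 0), (Y, X, 0)}"
      "s = (\<lambda>(b1, b2, b3). vec_nth (tri b1 b2 b3 + (\<chi> k. if k \<in> J then w else 0))) b"
      using s unfolding square_patterns_def by (rule imageE)
    obtain b1 b2 b3 where b': "b = (b1, b2, b3)" by (cases b)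
    have s': "s i1 = b1" "s i2 = b2" "s i3 = b3" "\<forall>j\<in>J. s j = w" by (auto simp: b b')
    have "(b1 = 0 \<and> b2 \<noteq> 0 \<and> b3 \<noteq> 0) \<or> (b1 \<noteq> 0 \<and> b2 = 0 \<and> b3 \<noteq> 0) \<or> (b1 \<noteq> 0 \<and> b2 \<noteq> 0 \<and> b3 = 0)"
      using b pos by (auto simp: b')
    then have "(\<forall>k. s k = 0 \<longleftrightarrow> k = i1) \<or> (\<forall>k. s k = 0 \<longleftrightarrow> k = i2) \<or> (\<forall>k. s k = 0 \<longleftrightarrow> k = i3)"
      unfolding all_split using s' pos distinct by (auto simp: J_def)
    then obtain i where i: "\<And>k. s k = 0 \<longleftrightarrow> k = i" by blast
    have "card (?V s) = (\<Prod>k\<in>UNIV. if k = i then 1 else 2)"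
      unfolding card_vec_box by (intro prod.cong) (auto simp: card_square_roots i)
    also have "\<dots> = (\<Prod>k\<in>UNIV - {i}. 2)"
      by (subst prod.remove[of _ i]) auto
    finally show ?thesis by (simp add: card_Diff_singleton)
  qed
  have "card square_patterns = 6"
  proof -
    have "inj_on (\<lambda>(b1, b2, b3). vec_nth (tri b1 b2 b3 + (\<chi> k. if k \<in> J then w else 0)))
      {(0, X, Y), (0, Y, X), (X, 0, Y), (Y, 0, X), (X, Y, 0), (Y, X, 0)}"
    proof (rule inj_onI)
      fix t t' :: "real \<times> real \<times> real"
      assume eq: "(\<lambda>(b1, b2, b3). vec_nth (tri b1 b2 b3 + (\<chi> k. if k \<in> J then w else 0))) t =
        (\<lambda>(b1, b2, b3). vec_nth (tri b1 b2 b3 + (\<chi> k. if k \<in> J then w else 0))) t'"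
      show "t = t'"
        using fun_cong[OF eq, of i1] fun_cong[OF eq, of i2] fun_cong[OF eq, of i3]
        by (cases t, cases t') simp
    qed
    then show ?thesis
      unfolding square_patterns_def using XY pos by (simp add: card_image)
  qed
  moreover have disj: "?V s \<inter> ?V t = {}" if "s \<noteq> t" for s t
    using that by (auto simp: fun_eq_iff)
  moreover have finV: "finite (?V s)" if "s \<in> square_patterns" for s
    using cardV[OF that] card.infinite by fastforce
  ultimately show "card directions = 6 * 2 ^ (CARD('n) - 1)"
    unfolding directions_def using fin cardV by (subst card_UN_disjoint) auto
  show "finite directions" unfolding directions_def using fin finV by blast
qed

lemma card_config_sols: "card config_sols = 6 * 2 ^ (CARD('n) - 1)" "finite config_sols"
  using card_directions unfolding config_sols_eq
  by (auto simp: card_image inj_on_def)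

section \<open>Reality, nondegeneracy and behaviour at infinity\<close>

lemma config_sols_real:
  assumes "(p, v) \<in> config_sols"
  shows "\<exists>p' v'. p = cvec p' \<and> v = cvec v'"
proof -
  have v: "v \<in> directions" "p = foot v" using assms by (auto simp: config_sols_eq)
  have real: "z \<in> \<real>" if "z\<^sup>2 = of_real s" "s \<ge> 0" for z :: complex and s
  proof -
    have "z\<^sup>2 = (of_real (sqrt s))\<^sup>2" using that by (simp flip: of_real_power)
    then have "z = of_real (sqrt s) \<or> z = - of_real (sqrt s)" by (simp only: power2_eq_iff)
    then show ?thesis by auto
  qed
  have "v $ k \<in> \<real>" for k
  proof -
    obtain s where "s \<in> square_patterns" "(v $ k)\<^sup>2 = of_real (s k)"
      using v(1) by (auto simp: directions_def)
    moreover from this have "s k \<ge> 0"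
      using pos by (auto simp: square_patterns_def tri_def)
    ultimately show ?thesis using real by blast
  qed
  then have v': "v = cvec (\<chi> k. Re (v $ k))"
    by (simp add: vec_eq_iff)
  have "p = cvec (\<chi> k. Re (p $ k))"
    unfolding v(2) vec_eq_iff foot_def tri_def
    using \<open>\<And>k. v $ k \<in> \<real>\<close> by (auto simp: of_real_Re)
  then show ?thesis using v' by blast
qed

lemma config_spanning:
  assumes "\<forall>c\<in>centers. cdot v (cvec c) = 0"
  shows "v = 0"
proof -
  have "v$i1 + v$i2 + v$i3 = 0" "v$i1 - v$i2 - v$i3 = 0" "- v$i1 + v$i2 - v$i3 = 0" 
    "\<forall>j\<in>J. v$j = 0"
    using assms pos unfolding ball_centers by auto
  moreover from this have "v$i1 = 0" "v$i2 = 0" "v$i3 = 0" by algebra+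
  ultimately show ?thesis by (simp add: vec_eq_iff_split)
qed

text \<open>The hypotheses are the linearized system, up to factors \<open>2\<close>. The center
  equations express \<open>dp\<close> through \<open>dv\<close> and give
  \<open>\<kappa> = 0\<close>, which kills \<open>dv\<close> on \<open>J\<close>. At the tetrahedral
  coordinate where \<open>v\<close> vanishes, the variation is controlled by
  \<open>cdot p v\<close>; the other two satisfy a linear system whose determinant is
  \<open>X - Y\<close> up to sign.\<close>

lemma config_jacobian:
  assumes sol: "(p, v) \<in> config_sols"
    and dv: "cdot v dv = 0" and dpv: "cdot dp v + cdot p dv = 0"
    and d: "\<forall>c\<in>centers. cdot p dp - cdot dp (cvec c) - cdot v (cvec c) * cdot dv (cvec c) = 0"
  shows "dp = 0 \<and> dv = 0"
proof -
  have v: "v \<in> directions" "p = foot v" using sol by (auto simp: config_sols_eq)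
  have p: "p$i1 = - (v$i2 * v$i3)" "p$i2 = - (v$i1 * v$i3)" "p$i3 = - (v$i1 * v$i2)" "\<And>j. j \<in> J \<Longrightarrow> p$j = 0"
    by (simp_all add: v foot_def)
  define \<kappa> where "\<kappa> = cdot p dp"
  have "\<forall>c\<in>centers. \<kappa> + 0 = cdot dp (cvec c) + cdot v (cvec c) * cdot dv (cvec c)"
    using d by (simp add: \<kappa>_def algebra_simps)
  note E = center_equations_solve[where h = "\<lambda>_. 0", OF this]
  have "cdot v dv = \<kappa> + (\<Sum>j\<in>J. v$j * dv$j)" using E(4) by (simp add: cdot_split)
  moreover have "of_real (a\<^sup>2) * (\<Sum>j\<in>J. v$j * dv$j) = of_nat (card J) * \<kappa>"
    by (simp add: sum_distrib_left E(6)[symmetric] del: of_real_power)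
  ultimately have "of_real (a\<^sup>2) * (\<kappa> - 0) = - of_nat (card J) * (\<kappa> - 0)"
    using dv by algebra
  then have \<kappa>0: "\<kappa> = 0" by (rule linear_equation_unique)
  have "(v$j)\<^sup>2 \<noteq> 0" if "j \<in> J" for j
    using v(1) that pos unfolding directions_iff by auto
  then have dvJ: "dv$j = 0" if "j \<in> J" for j
    using E(6)[OF that] that \<kappa>0 pos by auto
  have D: "cdot dp v + cdot p dv = -3 * (v$i1 * v$i2 * dv$i3 + v$i1 * v$i3 * dv$i2 + v$i2 * v$i3 * dv$i1)"
    by (simp add: cdot_split E(1,2,3,5) p algebra_simps)
  then have D0: "v$i1 * v$i2 * dv$i3 + v$i1 * v$i3 * dv$i2 + v$i2 * v$i3 * dv$i1 = 0"
    using dpv by algebra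
  have "\<kappa> = (v$i2 * v$i3) * (v$i2 * dv$i3 + v$i3 * dv$i2) + (v$i1 * v$i3) * (v$i1 * dv$i3 + v$i3 * dv$i1)
      + (v$i1 * v$i2) * (v$i1 * dv$i2 + v$i2 * dv$i1)"
    unfolding \<kappa>_def by (simp add: cdot_split E(1,2,3,5) p algebra_simps)
  then have K: "(v$i2 * v$i3) * (v$i2 * dv$i3 + v$i3 * dv$i2) + (v$i1 * v$i3) * (v$i1 * dv$i3 + v$i3 * dv$i1)
      + (v$i1 * v$i2) * (v$i1 * dv$i2 + v$i2 * dv$i1) = 0"
    using \<kappa>0 by simp
  have S: "v$i1 * dv$i1 + v$i2 * dv$i2 + v$i3 * dv$i3 = 0" using E(4) \<kappa>0 by simp
  have two: "x' = 0 \<and> y' = 0"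
    if "x * y * (x * y' + y * x') = 0" "x * x' + y * y' = 0" "x \<noteq> 0" "y \<noteq> 0" "x\<^sup>2 \<noteq> y\<^sup>2"
    for x y x' y' :: complex
  proof -
    have 0: "x * y' + y * x' = 0" using that by simp
    have "(x\<^sup>2 - y\<^sup>2) * x' = 0" "(x\<^sup>2 - y\<^sup>2) * y' = 0"
      using 0 that(2) by algebra+
    then show ?thesis using that(5) by simp
  qed
  have XY': "complex_of_real X \<noteq> of_real Y" "X \<noteq> 0" "Y \<noteq> 0" using XY pos by auto
  have nz: "z\<^sup>2 = of_real X \<or> z\<^sup>2 = of_real Y \<longrightarrow> z \<noteq> 0" for z :: complex
    using XY' by auto
  have "dv$i1 = 0 \<and> dv$i2 = 0 \<and> dv$i3 = 0"
  proof -
    consider "v$i1 = 0" "v$i2 \<noteq> 0" "v$i3 \<noteq> 0" "(v$i2)\<^sup>2 \<noteq> (v$i3)\<^sup>2"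
      | "v$i2 = 0" "v$i1 \<noteq> 0" "v$i3 \<noteq> 0" "(v$i1)\<^sup>2 \<noteq> (v$i3)\<^sup>2"
      | "v$i3 = 0" "v$i1 \<noteq> 0" "v$i2 \<noteq> 0" "(v$i1)\<^sup>2 \<noteq> (v$i2)\<^sup>2"
      using v(1) XY' nz[of "v$i1"] nz[of "v$i2"] nz[of "v$i3"] unfolding directions_iff by auto
    then show ?thesis
    proof cases
      case 1
      then show ?thesis using D0 two[of "v$i2" "v$i3" "dv$i3" "dv$i2"] K S by auto
    next
      case 2
      then show ?thesis using D0 two[of "v$i1" "v$i3" "dv$i3" "dv$i1"] K S by auto
    next
      case 3
      then show ?thesis using D0 two[of "v$i1" "v$i2" "dv$i2" "dv$i1"] K S by auto
    qed
  qed
  then show ?thesis using dvJ E(1-3,5) by (simp add: vec_eq_iff_split)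
qed

text \<open>With weights \<open>1\<close> for \<open>v\<close> and \<open>2\<close> for
  \<open>p\<close>, these are the top-weight parts of \<open>cdot v v = 1\<close>, of
  \<open>cdot p v = 0\<close>, of a sphere equation, and of the differences of sphere equations. As
  for finite solutions, all symmetric functions of the first three squares are determined, now with
  value \<open>0\<close>.\<close>

lemma config_no_sols_at_infinity:
  assumes uu: "cdot u u = 0" and qu: "cdot q u = 0" and qq: "cdot q q = 0"
    and E: "\<forall>c\<in>centers. 2 * cdot q (cvec c) + (cdot u (cvec c))\<^sup>2 = \<kappa>"
  shows "q = 0 \<and> u = 0"
proof -
  have "\<forall>c\<in>centers. \<kappa> + 0 = cdot (2 *s q) (cvec c) + cdot u (cvec c) * cdot u (cvec c)"
    using E by (auto simp: power2_eq_square)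
  note E = center_equations_solve[where h = "\<lambda>_. 0", OF this]
  have q: "q$i1 = - (u$i2 * u$i3)" "q$i2 = - (u$i1 * u$i3)" "q$i3 = - (u$i1 * u$i2)" "\<forall>j\<in>J. q$j = 0"
    using E(1-3,5) by (auto simp: mult.commute)
  have "cdot u u = \<kappa> + (\<Sum>j\<in>J. u$j * u$j)" using E(4) by (simp add: cdot_split)
  moreover have "of_real (a\<^sup>2) * (\<Sum>j\<in>J. u$j * u$j) = of_nat (card J) * \<kappa>"
    by (simp add: sum_distrib_left E(6)[symmetric] del: of_real_power)
  ultimately have "of_real (a\<^sup>2) * (\<kappa> - 0) = - of_nat (card J) * (\<kappa> - 0)"
    using uu by algebra
  then have \<kappa>0: "\<kappa> = 0" by (rule linear_equation_unique)
  then have uJ: "\<forall>j\<in>J. u$j = 0" using E(6) pos by auto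
  have "cdot q u = -3 * (u$i1 * u$i2 * u$i3)" using q by (simp add: cdot_split)
  then have 1: "u$i1 * u$i2 * u$i3 = 0" using qu by simp
  have 2: "(u$i2 * u$i3)\<^sup>2 + (u$i1 * u$i3)\<^sup>2 + (u$i1 * u$i2)\<^sup>2 = 0"
    using qq q by (simp add: cdot_split power2_eq_square)
  have 3: "(u$i1)\<^sup>2 + (u$i2)\<^sup>2 + (u$i3)\<^sup>2 = 0" using E(4) \<kappa>0 by (simp add: power2_eq_square)
  have "u$i1 = 0 \<and> u$i2 = 0 \<and> u$i3 = 0"
    using 1 2 3 by auto
  then show ?thesis using q uJ by (simp add: vec_eq_iff_split)
qed

lemma card_centers: "card centers \<le> 2 * CARD('n) - 2" "finite centers" "centers \<noteq> {}"
proof -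
  have "card (UNIV :: 'n set) = 3 + card J"
    unfolding UNIV_eq using distinct by simp
  moreover have "card centers \<le> 4 + card J + card J"
    unfolding centers_def
    by (intro order.trans[OF card_Un_le] add_mono card_image_le order.trans[OF card_insert_le_m1]) auto
  ultimately show "card centers \<le> 2 * CARD('n) - 2" by simp
qed (auto simp: centers_def)

lemma enumerate_centers: "\<exists>c. c ` {..<2 * CARD('n) - 2} = centers"
proof -
  obtain f where f: "bij_betw f {0..<card centers} centers"
    using ex_bij_betw_nat_finite[OF card_centers(2)] by blast
  obtain z where z: "z \<in> centers" using card_centers(3) by blast
  have f': "f ` {0..<card centers} = centers" using f by (simp add: bij_betw_def)
  \<comment> \<open>Only the image matters: indices beyond \<open>card centers\<close> default to
    \<open>z\<close>.\<close>
  have "(\<lambda>i. if i < card centers then f i else z) ` {..<2 * CARD('n) - 2} = centers"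
  proof (intro equalityI subsetI)
    fix c assume "c \<in> (\<lambda>i. if i < card centers then f i else z) ` {..<2 * CARD('n) - 2}"
    then show "c \<in> centers" using f' z by (auto split: if_splits)
  next
    fix c assume "c \<in> centers"
    then have "c \<in> f ` {0..<card centers}" using f' by simp
    then obtain i where "i < card centers" "c = f i" by auto
    then show "c \<in> (\<lambda>i. if i < card centers then f i else z) ` {..<2 * CARD('n) - 2}"
      using card_centers(1) by (intro image_eqI[of _ _ i]) auto
  qed
  then show ?thesis by blast
qed

end

lemma tetra_config_exists:
  assumes "CARD('n::finite) \<ge> 3"
  shows "\<exists>(i1::'n) i2 i3 J a w X Y r. tetra_config i1 i2 i3 J a w X Y r"
proof -
  obtain A :: "'n set" where A: "card A = 3" "finite A"
    using assms by (metis obtain_subset_with_card_n)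
  then obtain i1 i2 i3 where i: "A = {i1, i2, i3}" "i1 \<noteq> i2" "i1 \<noteq> i3" "i2 \<noteq> i3"
    by (metis card_3_iff)
  define J where "J = UNIV - {i1, i2, i3}"
  define m where "m = real (card J)"
  show ?thesis
  proof (cases "card J = 0")
    case True
    \<comment> \<open>Without further axes \<open>X + Y = 1\<close>; then \<open>a = 2\<close>,
      \<open>w = 1/2\<close> satisfy \<open>w_eq\<close>, and \<open>r_eq\<close> reads
      \<open>3 - 1 + 3/16 = 35/16\<close>.\<close>
    have "tetra_config i1 i2 i3 J 2 (1/2) (1/4) (3/4) (sqrt (35/16))"
      by unfold_locales (use i True J_def in \<open>auto simp: power2_eq_square\<close>)
    then show ?thesis by blast
  next
    case False
    then have "card J \<ge> 1" by linarith
    then have m: "m \<ge> 1" by (simp add: m_def)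
    \<comment> \<open>The choice \<open>w = X + Y = S\<close> turns the sum condition into
      \<open>(m + 1) * S = 1\<close> and \<open>w_eq\<close> into
      \<open>a^2 * (1 - S) = 3 - S\<close>, solvable since \<open>S < 1\<close>. That fails for
      \<open>m = 0\<close>, hence the separate case. The split of \<open>S\<close> into
      \<open>S/4\<close> and \<open>3*S/4\<close> makes \<open>X\<close> and \<open>Y\<close>
      distinct.\<close>
    define S where "S = 1 / (m + 1)"
    have S: "0 < S" "S \<le> 1/2" using m by (auto simp: S_def field_simps)
    have Sm: "S + m * S = 1" using m by (simp add: S_def field_simps)
    define a where "a = sqrt ((3 - S) / (1 - S))"
    have a: "a > 0" "a\<^sup>2 * (1 - S) = 3 - S" using S by (auto simp: a_def)
    define r where "r = sqrt (3 - S + S/4 * (3*S/4))"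
    have "3 - S + S/4 * (3*S/4) > 0" using S by (intro add_pos_nonneg) auto
    then have r: "r > 0" "r\<^sup>2 = 3 - S + S/4 * (3*S/4)" by (auto simp: r_def)
    have "tetra_config i1 i2 i3 J a S (S/4) (3*S/4) r"
    proof unfold_locales
      show "J = UNIV - {i1, i2, i3}" by (rule J_def)
      show "S / 4 + 3 * S / 4 + real (card J) * S = 1" using Sm by (simp add: m_def)
    qed (use i S a r in \<open>auto simp: algebra_simps\<close>)
    then show ?thesis by blast
  qed
qed

subsection \<open>Persistence of nondegenerate zeros\<close>

text \<open>The implicit function theorem, from the inverse function theorem for
  \<open>\<Phi> (t, z) = (t, F (t, z))\<close>: a kernel vector of its derivative has zero
  \<open>t\<close>-component, and injectivity gives invertibility in finite dimension. The bound
  \<open>\<delta>\<close> allows balls around different zeros to be kept disjoint.\<close>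

lemma nondegenerate_zero_persists:
  fixes F :: "real \<times> 'a::euclidean_space \<Rightarrow> 'a"
  assumes der: "\<And>x. (F has_derivative D x) (at x)"
    and cont: "\<And>h. continuous_on UNIV (\<lambda>x. D x h)"
    and zero: "F (0, z0) = 0" and inj: "\<And>h. D (0, z0) (0, h) = 0 \<Longrightarrow> h = 0"
    and "\<delta> > 0"
  shows "\<exists>r>0. r \<le> \<delta> \<and> (\<forall>\<^sub>F t in nhds 0. \<exists>!z. z \<in> ball z0 r \<and> F (t, z) = 0)"
proof -
  define \<Phi> where "\<Phi> x = (fst x, F x)" for x
  define D' where "D' x h = (fst h, D x h)" for x and h :: "real \<times> 'a"
  have der': "(\<Phi> has_derivative D' x) (at x)" for x
    unfolding \<Phi>_def D'_def by (intro has_derivative_Pair der has_derivative_fst has_derivative_ident)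
  have bl: "bounded_linear (D' x)" for x using der' has_derivative_bounded_linear by blast
  define B where "B x = Blinfun (D' x)" for x
  have B: "blinfun_apply (B x) = D' x" for x
    by (simp add: B_def bounded_linear_Blinfun_apply[OF bl])
  have contB: "continuous_on UNIV B"
    by (rule continuous_on_blinfun_componentwise)
      (simp add: B D'_def continuous_on_Pair cont)
  have "inj (D' (0, z0))"
  proof (rule linear_injective_0[THEN iffD2])
    show "linear (D' (0, z0))" using bl by (simp add: bounded_linear.linear)
    show "\<forall>x. D' (0, z0) x = 0 \<longrightarrow> x = 0" by (auto simp: D'_def zero_prod_def inj)
  qed
  then obtain g where g: "linear g" "g \<circ> D' (0, z0) = id"
    using linear_injective_left_inverse[of "D' (0, z0)"] bl bounded_linear.linear by blast
  have "bounded_linear g" using g(1) by (simp add: linear_conv_bounded_linear)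
  then have "Blinfun g o\<^sub>L B (0, z0) = id_blinfun"
    by (intro blinfun_eqI) (simp add: bounded_linear_Blinfun_apply B pointfree_idE[OF g(2)])
  then obtain U V G where U: "open U" "(0, z0) \<in> U" "open V" and hom: "homeomorphism U V \<Phi> G"
    using inverse_function_theorem[of UNIV \<Phi> B "(0, z0)" "Blinfun g"] der' contB B
    by (metis UNIV_I open_UNIV)
  obtain A C where AC: "open A" "open C" "0 \<in> A" "z0 \<in> C" "A \<times> C \<subseteq> U"
    using U(1,2) by (auto elim: open_prod_elim)
  obtain r' where r': "r' > 0" "ball z0 r' \<subseteq> C" using AC openE by blast
  define r where "r = min r' \<delta>"
  have r: "r > 0" "r \<le> \<delta>" "ball z0 r \<subseteq> C" using r' \<open>\<delta> > 0\<close> by (auto simp: r_def)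
  let ?W = "A \<times> ball z0 r"
  have W: "?W \<subseteq> U" "open ?W" using AC r by (auto intro: open_Times)
  \<comment> \<open>Openness of the image gives a zero for small \<open>t\<close>; injectivity of
    \<open>\<Phi>\<close> on \<open>U\<close> gives its uniqueness.\<close>
  have "openin (top_of_set V) (\<Phi> ` ?W)"
    using homeomorphism_imp_open_map[OF hom, of ?W] W by (simp add: openin_open_eq U(1))
  then have opW: "open (\<Phi> ` ?W)" using U(3) by (simp add: openin_open_eq)
  have "(0, 0) \<in> \<Phi> ` ?W"
    using AC r zero by (intro image_eqI[of _ _ "(0, z0)"]) (auto simp: \<Phi>_def)
  then obtain A' C' where A': "open A'" "0 \<in> A'" "0 \<in> C'" "A' \<times> C' \<subseteq> \<Phi> ` ?W"
    using opW by (auto elim: open_prod_elim)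
  have "\<forall>\<^sub>F t in nhds 0. t \<in> A' \<and> t \<in> A"
    using A' AC by (intro eventually_conj eventually_nhds_in_open)
  then have "\<forall>\<^sub>F t in nhds 0. \<exists>!z. z \<in> ball z0 r \<and> F (t, z) = 0"
  proof (rule eventually_mono)
    fix t assume t: "t \<in> A' \<and> t \<in> A"
    then have "(t, 0) \<in> \<Phi> ` ?W" using A' by blast
    then obtain z where z: "z \<in> ball z0 r" "F (t, z) = 0" by (auto simp: \<Phi>_def)
    have "z' = z" if "z' \<in> ball z0 r" "F (t, z') = 0" for z'
    proof -
      have "(t, z) \<in> U" "(t, z') \<in> U" using W(1) t z(1) that(1) by auto
      moreover have "\<Phi> (t, z) = \<Phi> (t, z')" using z(2) that(2) by (simp add: \<Phi>_def)
      ultimately have "(t, z) = (t, z')" using hom by (metis homeomorphism_apply1)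
      then show ?thesis by simp
    qed
    then show "\<exists>!z. z \<in> ball z0 r \<and> F (t, z) = 0" using z by blast
  qed
  then show ?thesis using r by blast
qed

text \<open>Each old zero continues to exactly one zero in a small ball. The rest of the ball of
  radius \<open>B\<close> is compact and free of zeros at \<open>t = 0\<close>, hence for small
  \<open>t\<close> by the tube lemma, and no zero lies outside that ball.\<close>

theorem card_zeros_locally_constant:
  fixes F :: "real \<times> 'a::euclidean_space \<Rightarrow> 'a"
  assumes der: "\<And>x. (F has_derivative D x) (at x)"
    and cont: "\<And>h. continuous_on UNIV (\<lambda>x. D x h)"
    and inj: "\<And>z h. F (0, z) = 0 \<Longrightarrow> D (0, z) (0, h) = 0 \<Longrightarrow> h = 0"
    and fin: "finite {z. F (0, z) = 0}"
    and bounded: "\<forall>\<^sub>F t in nhds 0. \<forall>z. F (t, z) = 0 \<longrightarrow> norm z \<le> B"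
  shows "\<forall>\<^sub>F t in nhds 0. finite {z. F (t, z) = 0} \<and> card {z. F (t, z) = 0} = card {z. F (0, z) = 0}"
proof -
  define Z where "Z = {z. F (0, z) = 0}"
  \<comment> \<open>Radii at most half the distance to any other zero make the balls
    disjoint.\<close>
  have "\<forall>z. \<exists>d>0. \<forall>x\<in>Z. x \<noteq> z \<longrightarrow> d \<le> dist z x"
    using fin finite_set_avoid[of Z] by (auto simp: Z_def)
  then obtain d where d: "\<And>z. d z > 0" "\<And>z x. x \<in> Z \<Longrightarrow> x \<noteq> z \<Longrightarrow> d z \<le> dist z x"
    by (auto dest!: choice)
  have "\<forall>z0\<in>Z. \<exists>r>0. r \<le> d z0 / 2 \<and> (\<forall>\<^sub>F t in nhds 0. \<exists>!z. z \<in> ball z0 r \<and> F (t, z) = 0)"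
  proof
    fix z0 assume "z0 \<in> Z"
    then have "F (0, z0) = 0" by (simp add: Z_def)
    then show "\<exists>r>0. r \<le> d z0 / 2 \<and> (\<forall>\<^sub>F t in nhds 0. \<exists>!z. z \<in> ball z0 r \<and> F (t, z) = 0)"
      using d(1)[of z0] by (intro nondegenerate_zero_persists[OF der cont]) (auto intro: inj)
  qed
  then obtain r where r: "\<And>z0. z0 \<in> Z \<Longrightarrow> r z0 > 0" "\<And>z0. z0 \<in> Z \<Longrightarrow> r z0 \<le> d z0 / 2"
    "\<And>z0. z0 \<in> Z \<Longrightarrow> \<forall>\<^sub>F t in nhds 0. \<exists>!z. z \<in> ball z0 (r z0) \<and> F (t, z) = 0"
    by (auto dest!: bchoice)
  have disj: "z1 = z2" if "z1 \<in> Z" "z2 \<in> Z" "z \<in> ball z1 (r z1)" "z \<in> ball z2 (r z2)" for z z1 z2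
  proof (rule ccontr)
    assume "z1 \<noteq> z2"
    then have "d z1 \<le> dist z1 z2" "d z2 \<le> dist z1 z2"
      using d(2)[of z2 z1] d(2)[of z1 z2] that by (auto simp: dist_commute)
    moreover have "dist z1 z2 < r z1 + r z2"
      using that(3,4) dist_triangle[of z1 z2 z] by (simp add: dist_commute)
    ultimately show False using r(2)[OF that(1)] r(2)[OF that(2)] by simp
  qed
  define K where "K = cball 0 B - (\<Union>z0\<in>Z. ball z0 (r z0))"
  have K: "compact K" unfolding K_def by (intro compact_diff open_UN) auto
  have contF: "continuous_on UNIV F"
    using der by (meson continuous_at_imp_continuous_on has_derivative_continuous)
  have opF: "open {x. F x \<noteq> 0}" using contF by (intro open_Collect_neq) auto
  have subF: "{0} \<times> K \<subseteq> {x. F x \<noteq> 0}"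
    using r(1) by (auto simp: K_def Z_def)
  from Elementary_Topology.tube_lemma[OF K opF subF]
  obtain X0 where X0: "0 \<in> X0" "open X0" "X0 \<times> K \<subseteq> {x. F x \<noteq> 0}" by (elim exE conjE)
  have ev1: "\<forall>\<^sub>F t in nhds 0. t \<in> X0" using X0 by (intro eventually_nhds_in_open)
  have "\<forall>\<^sub>F t in nhds 0. \<forall>z0\<in>Z. \<exists>!z. z \<in> ball z0 (r z0) \<and> F (t, z) = 0"
    using fin r(3) by (intro eventually_ball_finite) (auto simp: Z_def)
  with ev1 bounded show ?thesis
  proof eventually_elim
    case (elim t)
    define \<zeta> where "\<zeta> z0 = (THE z. z \<in> ball z0 (r z0) \<and> F (t, z) = 0)" for z0
    have \<zeta>: "\<zeta> z0 \<in> ball z0 (r z0) \<and> F (t, \<zeta> z0) = 0" if "z0 \<in> Z" for z0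
      unfolding \<zeta>_def using theI'[OF elim(3)[rule_format, OF that]] .
    have "bij_betw \<zeta> Z {z. F (t, z) = 0}"
      unfolding bij_betw_def
    proof (intro conjI equalityI subsetI)
      show "inj_on \<zeta> Z"
      proof (rule inj_onI)
        fix z1 z2 assume z: "z1 \<in> Z" "z2 \<in> Z" "\<zeta> z1 = \<zeta> z2"
        show "z1 = z2" using disj[OF z(1,2), of "\<zeta> z1"] \<zeta>[OF z(1)] \<zeta>[OF z(2)] z(3) by simp
      qed
      show "z \<in> {z. F (t, z) = 0}" if "z \<in> \<zeta> ` Z" for z using that \<zeta> by blast
      show "z \<in> \<zeta> ` Z" if z: "z \<in> {z. F (t, z) = 0}" for z
      proof -
        have "z \<notin> K" using z elim(1) X0(3) by blast
        moreover have "norm z \<le> B" using z elim(2) by blast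
        ultimately obtain z0 where z0: "z0 \<in> Z" "z \<in> ball z0 (r z0)" by (auto simp: K_def)
        then have "z = \<zeta> z0" using elim(3) \<zeta>[OF z0(1)] z by blast
        then show ?thesis using z0 by blast
      qed
    qed
    then show ?case
      using fin bij_betw_finite bij_betw_same_card unfolding Z_def by metis
  qed
qed

subsection \<open>Deforming the configuration\<close>

lemma has_derivative_vec_lambda:
  fixes f :: "'i::finite \<Rightarrow> 'a::real_normed_vector \<Rightarrow> 'b::real_normed_vector"
  assumes "\<And>i. (f i has_derivative f' i) F"
  shows "((\<lambda>x. \<chi> i. f i x) has_derivative (\<lambda>h. \<chi> i. f' i h)) F"
proof -
  have eq: "(\<chi> i. u i) = (\<Sum>i\<in>UNIV. axis i (u i))" for u :: "'i \<Rightarrow> 'b"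
    by (simp add: vec_eq_iff axis_def)
  have ax: "bounded_linear (axis i :: 'b \<Rightarrow> 'b^'i)" for i
  proof (rule bounded_linear_intro[of _ 1])
    show "norm (axis i x :: 'b^'i) \<le> norm x * 1" for x :: 'b
      unfolding norm_vec_def
      by (rule order.trans[OF L2_set_le_sum]) (auto simp: axis_def if_distrib[of norm] cong: if_cong)
  qed (auto simp: vec_eq_iff axis_def)
  show ?thesis
    unfolding eq by (intro has_derivative_sum bounded_linear.has_derivative[OF ax] assms)
qed

definition sphere_eq ::
  "complex^'n \<Rightarrow> complex^'n \<Rightarrow> complex^'n \<Rightarrow> complex \<Rightarrow> complex" where
  "sphere_eq p v c r = cdot p p - 2 * cdot p c + cdot c c - cdot v c * cdot v c - r * r"

definition sphere_eq_deriv ::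
  "complex^'n \<Rightarrow> complex^'n \<Rightarrow> complex^'n \<Rightarrow> complex \<Rightarrow>
   complex^'n \<Rightarrow> complex^'n \<Rightarrow> complex^'n \<Rightarrow> complex \<Rightarrow> complex" where
  "sphere_eq_deriv p v c r p' v' c' r' =
     (cdot p p' + cdot p' p) - 2 * (cdot p c' + cdot p' c) + (cdot c c' + cdot c' c)
       - (cdot v c * (cdot v c' + cdot v' c) + (cdot v c' + cdot v' c) * cdot v c) - (r * r' + r' * r)"

lemma has_derivative_sphere_eq:
  assumes "(p has_derivative p') (at x)" "(v has_derivative v') (at x)"
    "(c has_derivative c') (at x)" "(r has_derivative r') (at x)"
  shows "((\<lambda>x. sphere_eq (p x) (v x) (c x) (r x)) has_derivative
    (\<lambda>h. sphere_eq_deriv (p x) (v x) (c x) (r x) (p' h) (v' h) (c' h) (r' h))) (at x)"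
  unfolding sphere_eq_def sphere_eq_deriv_def
  by (intro has_derivative_add has_derivative_diff has_derivative_mult has_derivative_mult_right
      cdot.FDERIV assms)

lemma tangent_eq_normal:
  "cdot v v = 1 \<Longrightarrow> tangent_eq p v c r \<longleftrightarrow> sphere_eq p v c r = 0"
  by (simp add: tangent_eq_def sphere_eq_def power2_eq_square)

lemma cvec_add_scaleR: "cvec (x + t *\<^sub>R y) = cvec x + t *\<^sub>R cvec y"
  by (simp add: cvec_def vec_eq_iff scaleR_conv_of_real[where 'a = complex])

text \<open>The scaling \<open>u = s v\<close>, \<open>q = s\<^sup>2 p\<close> with \<open>\<parallel>u\<parallel>\<^sup>2 + \<parallel>q\<parallel> = 1\<close> turns unbounded families of
  solutions into solutions at infinity (\<open>s = 0\<close>).\<close>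

lemma normal_sols_bounded:
  fixes c d :: "nat \<Rightarrow> real^'n" and r \<rho> :: "nat \<Rightarrow> real"
  assumes inf: "\<And>q u \<kappa>. cdot u u = 0 \<Longrightarrow> cdot q u = 0 \<Longrightarrow> cdot q q = 0 \<Longrightarrow>
      (\<forall>i<m. 2 * cdot q (cvec (c i)) + (cdot u (cvec (c i)))\<^sup>2 = \<kappa>) \<Longrightarrow> q = 0 \<and> u = 0"
    and "m > 0"
  shows "\<exists>B. \<forall>\<^sub>F t in nhds 0. \<forall>z. z \<in> normal_sols m (\<lambda>i. c i + t *\<^sub>R d i) (\<lambda>i. r i + t * \<rho> i) \<longrightarrow> norm z \<le> B"
proof -
  define C where "C t i = cvec (c i) + t *\<^sub>R cvec (d i)" for t :: real and i
  define R where "R t i = complex_of_real (r i + t * \<rho> i)" for t i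
  \<comment> \<open>On a solution scaled by \<open>s\<close>, the sphere equation says that
    \<open>L\<close> equals \<open>s^2 * cdot p p\<close>, whatever \<open>i\<close> is.\<close>
  define L where "L t s q u i = 2 * cdot q (C t i) + (cdot u (C t i))\<^sup>2
      - of_real (s\<^sup>2) * (cdot (C t i) (C t i) - R t i * R t i)" for t s q u i
  \<comment> \<open>At \<open>s = 0\<close> the rescaled sphere equations all collapse to
    \<open>cdot q q = 0\<close>. The conditions on \<open>L\<close>, which are their differences
    divided by \<open>s^2\<close>, retain the information lost there and turn the fibre over
    \<open>s = 0\<close> into the system at infinity.\<close>
  define Z where "Z = {x :: (real \<times> real) \<times> (complex^'n) \<times> (complex^'n).
     cdot (snd (snd x)) (snd (snd x)) = of_real ((snd (fst x))\<^sup>2) \<and>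
     cdot (fst (snd x)) (snd (snd x)) = 0 \<and>
     (\<forall>i<m. cdot (fst (snd x)) (fst (snd x)) - 2 * of_real ((snd (fst x))\<^sup>2) * cdot (fst (snd x)) (C (fst (fst x)) i)
       + of_real ((snd (fst x)) ^ 4) * cdot (C (fst (fst x)) i) (C (fst (fst x)) i)
       - of_real ((snd (fst x))\<^sup>2) * (cdot (snd (snd x)) (C (fst (fst x)) i))\<^sup>2
       - of_real ((snd (fst x)) ^ 4) * (R (fst (fst x)) i * R (fst (fst x)) i) = 0) \<and>
     (\<forall>i<m. L (fst (fst x)) (snd (fst x)) (fst (snd x)) (snd (snd x)) i
         = L (fst (fst x)) (snd (fst x)) (fst (snd x)) (snd (snd x)) 0)}"
  have cC: "continuous_on UNIV (\<lambda>x. C (f x) i)" if "continuous_on UNIV f"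
    for f :: "(real \<times> real) \<times> (complex^'n) \<times> (complex^'n) \<Rightarrow> real" and i
    unfolding C_def by (intro continuous_intros that)
  have cR: "continuous_on UNIV (\<lambda>x. R (f x) i)" if "continuous_on UNIV f"
    for f :: "(real \<times> real) \<times> (complex^'n) \<times> (complex^'n) \<Rightarrow> real" and i
    unfolding R_def by (intro continuous_intros that)
  have "closed Z"
    unfolding Z_def L_def
    by (intro closed_Collect_conj closed_Collect_all closed_Collect_imp closed_Collect_eq
        open_Collect_const continuous_intros cC cR cdot.continuous_on)
  then have openW: "open (- Z)" by (simp add: open_Compl)
  \<comment> \<open>Compactness calls for the Hermitian norm, the bilinear form being indefinite;
    the exponents match the weights, so every nonzero pair scales into \<open>K\<close>.\<close>
  define K where "K = {y :: (complex^'n) \<times> (complex^'n). (norm (snd y))\<^sup>2 + norm (fst y) = 1}"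
  have "compact K"
  proof (rule compact_eq_bounded_closed[THEN iffD2], rule conjI)
    show "closed K" unfolding K_def by (intro closed_Collect_eq continuous_intros)
    show "bounded K"
    proof (rule boundedI)
      fix y assume "y \<in> K"
      then have y: "(norm (snd y))\<^sup>2 + norm (fst y) = 1" by (simp add: K_def)
      then have "norm (fst y) \<le> 1" "(norm (snd y))\<^sup>2 \<le> 1" by (smt (verit) norm_ge_zero zero_le_power2)+
      then have "norm (snd y) \<le> 1" by (simp add: power_le_one_iff abs_square_le_1)
      then show "norm y \<le> 2" using norm_Pair_le[of "fst y" "snd y"] \<open>norm (fst y) \<le> 1\<close> by simp
    qed
  qed
  moreover have "{(0, 0)} \<times> K \<subseteq> - Z"
  proof (rule subsetI, rule ComplI)
    fix x assume "x \<in> {(0 :: real, 0 :: real)} \<times> K" and "x \<in> Z"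
    moreover obtain a q u where "x = (a, q, u)" by (rule prod_cases3)
    ultimately have y: "(q, u) \<in> K" and z: "((0, 0), (q, u)) \<in> Z" by simp_all
    note Z = z[unfolded Z_def mem_Collect_eq fst_conv snd_conv]
    have "cdot u u = 0" using Z[THEN conjunct1] by simp
    moreover have "cdot q u = 0" using Z[THEN conjunct2, THEN conjunct1] .
    moreover have "cdot q q = 0"
      using Z[THEN conjunct2, THEN conjunct2, THEN conjunct1, rule_format, OF \<open>m > 0\<close>] by simp
    moreover have "\<forall>i<m. 2 * cdot q (cvec (c i)) + (cdot u (cvec (c i)))\<^sup>2
        = 2 * cdot q (cvec (c 0)) + (cdot u (cvec (c 0)))\<^sup>2"
    proof (intro allI impI)
      fix i assume "i < m"
      from Z[THEN conjunct2, THEN conjunct2, THEN conjunct2, rule_format, OF this]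
      show "2 * cdot q (cvec (c i)) + (cdot u (cvec (c i)))\<^sup>2
        = 2 * cdot q (cvec (c 0)) + (cdot u (cvec (c 0)))\<^sup>2" by (simp add: L_def C_def)
    qed
    ultimately have "q = 0 \<and> u = 0" by (rule inf)
    then show False using y by (simp add: K_def)
  qed
  ultimately obtain X0 where X0: "(0, 0) \<in> X0" "open X0" "X0 \<times> K \<subseteq> - Z"
    using Elementary_Topology.tube_lemma[OF _ openW, of K "(0, 0)"] by auto
  obtain A A' where A: "open A" "open A'" "0 \<in> A" "0 \<in> A'" "A \<times> A' \<subseteq> X0"
    using X0 by (auto elim: open_prod_elim)
  obtain e where e: "e > 0" "\<And>s. \<bar>s\<bar> < e \<Longrightarrow> s \<in> A'"
    using A(2,4) by (metis open_dist dist_real_def diff_0_right dist_commute)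
  \<comment> \<open>A solution with \<open>M > B\<close> has scale
    \<open>s = 1 / sqrt M < e\<close>, close enough to infinity for the tube lemma.\<close>
  define B where "B = 1 / e\<^sup>2"
  have "\<forall>\<^sub>F t in nhds 0. t \<in> A" using A by (intro eventually_nhds_in_open)
  then have "\<forall>\<^sub>F t in nhds 0. \<forall>z. z \<in> normal_sols m (\<lambda>i. c i + t *\<^sub>R d i) (\<lambda>i. r i + t * \<rho> i) \<longrightarrow> norm z \<le> 2 * B + 1"
  proof (rule eventually_mono, intro allI impI)
    fix t z assume t: "t \<in> A" and z: "z \<in> normal_sols m (\<lambda>i. c i + t *\<^sub>R d i) (\<lambda>i. r i + t * \<rho> i)"
    obtain p v where pv: "z = (p, v)" by (cases z)
    have vv: "cdot v v = 1" and pv0: "cdot p v = 0" 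
      and S: "\<And>i. i < m \<Longrightarrow> sphere_eq p v (C t i) (R t i) = 0"
      using z by (auto simp: normal_sols_def pv tangent_eq_normal C_def R_def cvec_add_scaleR)
    have "v \<noteq> 0" using vv by (auto simp: cdot.zero_left)
    define M where "M = (norm v)\<^sup>2 + norm p"
    have M: "M > 0" using \<open>v \<noteq> 0\<close> by (simp add: M_def add_pos_nonneg)
    have "M \<le> B"
    proof (rule ccontr)
      assume "\<not> M \<le> B"
      define s where "s = 1 / sqrt M"
      have s: "s > 0" "s\<^sup>2 * M = 1" using M by (auto simp: s_def power_divide)
      have "s < e"
      proof -
        have "1 / e < sqrt M"
          using \<open>\<not> M \<le> B\<close> e(1) by (intro real_less_rsqrt) (auto simp: B_def power_divide)
        then show ?thesis using e(1) M by (simp add: s_def field_simps)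
      qed
      then have "s \<in> A'" using e(2) s(1) by simp
      define q where "q = (s\<^sup>2) *\<^sub>R p"
      define u where "u = s *\<^sub>R v"
      have "(q, u) \<in> K"
        using s by (simp add: K_def q_def u_def M_def power_mult_distrib algebra_simps)
      have L: "L t s q u i = of_real (s\<^sup>2) * cdot p p" if "i < m" for i
      proof -
        have "cdot p p = 2 * cdot p (C t i) - cdot (C t i) (C t i) + cdot v (C t i) * cdot v (C t i) + R t i * R t i"
          using S[OF that] by (simp add: sphere_eq_def algebra_simps)
        then have pp: "of_real (s\<^sup>2) * cdot p p = of_real (s\<^sup>2) *
            (2 * cdot p (C t i) - cdot (C t i) (C t i) + cdot v (C t i) * cdot v (C t i) + R t i * R t i)"
          by simp
        show ?thesis
          unfolding pp by (simp add: L_def q_def u_def cdot.scaleR_left scaleR_conv_of_real[where 'a = complex] power2_eq_square algebra_simps)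
      qed
      have Q: "cdot q q - 2 * of_real (s\<^sup>2) * cdot q (C t i) + of_real (s ^ 4) * cdot (C t i) (C t i)
          - of_real (s\<^sup>2) * (cdot u (C t i))\<^sup>2 - of_real (s ^ 4) * (R t i * R t i) = 0" (is "?lhs = 0") if "i < m" for i
      proof -
        have "?lhs = of_real (s ^ 4) * sphere_eq p v (C t i) (R t i)"
          by (simp add: sphere_eq_def q_def u_def cdot.scaleR_left cdot.scaleR_right scaleR_conv_of_real[where 'a = complex]
              power2_eq_square power4_eq_xxxx algebra_simps)
        then show ?thesis using S[OF \<open>i < m\<close>] by simp
      qed
      have "((t, s), (q, u)) \<in> Z"
        using L \<open>m > 0\<close> Q vv pv0
        by (simp add: Z_def) (simp add: q_def u_def cdot.scaleR_left cdot.scaleR_right scaleR_conv_of_real[where 'a = complex] power2_eq_square)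
      moreover have "((t, s), (q, u)) \<in> X0 \<times> K"
        using A(5) t \<open>s \<in> A'\<close> \<open>(q, u) \<in> K\<close> by blast
      ultimately show False using X0(3) by blast
    qed
    moreover have "norm v \<le> 1 + (norm v)\<^sup>2"
    proof -
      have "0 \<le> (norm v - 1 / 2)\<^sup>2" by simp
      then show ?thesis by (simp add: power2_eq_square algebra_simps)
    qed
    moreover have "norm z \<le> norm p + norm v" unfolding pv by (rule norm_Pair_le)
    ultimately show "norm z \<le> 2 * B + 1" unfolding M_def by (smt (verit) norm_ge_zero zero_le_power2)
  qed
  then show ?thesis by blast
qed

text \<open>Failure to span is witnessed on the unit sphere, which is compact, so the tube lemma
  applies.\<close>

lemma spanning_persists:
  fixes c d :: "nat \<Rightarrow> real^'n"
  assumes "spanning m c"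
  shows "\<forall>\<^sub>F t in nhds 0. spanning m (\<lambda>i. c i + t *\<^sub>R d i)"
proof -
  define Z where "Z = {x :: real \<times> (complex^'n). \<forall>i<m. cdot (snd x) (cvec (c i) + fst x *\<^sub>R cvec (d i)) = 0}"
  have "closed Z"
    unfolding Z_def
    by (intro closed_Collect_all closed_Collect_imp closed_Collect_eq
        open_Collect_const continuous_intros cdot.continuous_on)
  then have "open (- Z)" by (simp add: open_Compl)
  moreover have "{0} \<times> sphere 0 1 \<subseteq> - Z"
  proof (rule subsetI, rule ComplI)
    fix x assume "x \<in> {0 :: real} \<times> sphere 0 1" and "x \<in> Z"
    moreover obtain a v where "x = (a, v)" by (rule prod.exhaust)
    ultimately have "v \<in> sphere 0 1" "(0, v) \<in> Z" by simp_all
    then have "v = 0" "norm v = 1" using assms by (auto simp: spanning_def Z_def)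
    then show False by simp
  qed
  ultimately obtain X0 where X0: "0 \<in> X0" "open X0" "X0 \<times> sphere 0 1 \<subseteq> - Z"
    using Elementary_Topology.tube_lemma[of "sphere 0 1 :: (complex^'n) set" "- Z" 0] by auto
  have "\<forall>\<^sub>F t in nhds 0. t \<in> X0" using X0 by (intro eventually_nhds_in_open)
  then show ?thesis
  proof (rule eventually_mono)
    fix t assume "t \<in> X0"
    show "spanning m (\<lambda>i. c i + t *\<^sub>R d i)"
      unfolding spanning_def
    proof (intro allI impI, rule ccontr)
      fix v :: "complex^'n"
      assume v: "\<forall>i<m. cdot v (cvec (c i + t *\<^sub>R d i)) = 0" "v \<noteq> 0"
      have "(1 / norm v) *\<^sub>R v \<in> sphere 0 1" using v(2) by simp
      moreover have "(t, (1 / norm v) *\<^sub>R v) \<in> Z"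
        using v(1) by (simp add: Z_def cdot.scaleR_left cvec_add_scaleR)
      ultimately show False using X0(3) \<open>t \<in> X0\<close> by blast
    qed
  qed
qed

context tetra_config
begin

text \<open>The \<open>m\<close> sphere equations with \<open>cdot p v = 0\<close> and
  \<open>cdot v v = 1\<close> are as many as the \<open>2 * CARD('n)\<close> complex unknowns; this
  balance makes the injective Jacobian invertible.\<close>

lemma config_persists:
  fixes c d :: "nat \<Rightarrow> real^'n" and \<rho> :: "nat \<Rightarrow> real"
  assumes m: "m = 2 * CARD('n) - 2" and c: "c ` {..<m} = centers"
  shows "\<forall>\<^sub>F t in nhds 0. finite (normal_sols m (\<lambda>i. c i + t *\<^sub>R d i) (\<lambda>i. r + t * \<rho> i)) \<and>
     card (normal_sols m (\<lambda>i. c i + t *\<^sub>R d i) (\<lambda>i. r + t * \<rho> i)) = 6 * 2 ^ (CARD('n) - 1)"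
proof -
  have "m > 0" using c card_centers(3) by (cases m) auto
  then have m2: "2 * CARD('n) = m + 2" using m by simp
  have "card (UNIV :: ('n + 'n) set) = m + 2"
    using m2 by (simp add: card_UNIV_sum)
  \<comment> \<open>Indexing by \<open>'n + 'n\<close> gives the equations the type of the unknowns;
    positions \<open>m\<close> and \<open>m + 1\<close> hold the two normalizations.\<close>
  then obtain e :: "'n + 'n \<Rightarrow> nat" where e: "bij_betw e UNIV {0..<m + 2}"
    using ex_bij_betw_finite_nat[of "UNIV :: ('n + 'n) set"] by auto
  define C where "C t i = cvec (c i) + t *\<^sub>R cvec (d i)" for t :: real and i
  define R where "R t i = complex_of_real (r + t * \<rho> i)" for t i
  define G where "G k x = (if k < m then sphere_eq (fst (snd x)) (snd (snd x)) (C (fst x) k) (R (fst x) k)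
      else if k = m then cdot (fst (snd x)) (snd (snd x)) else cdot (snd (snd x)) (snd (snd x)) - 1)"
    for k and x :: "real \<times> (complex^'n) \<times> (complex^'n)"
  define DG where "DG k x h = (if k < m then sphere_eq_deriv (fst (snd x)) (snd (snd x)) (C (fst x) k) (R (fst x) k)
        (fst (snd h)) (snd (snd h)) (fst h *\<^sub>R cvec (d k)) (complex_of_real (fst h * \<rho> k))
      else if k = m then cdot (fst (snd x)) (snd (snd h)) + cdot (fst (snd h)) (snd (snd x))
      else cdot (snd (snd x)) (snd (snd h)) + cdot (snd (snd h)) (snd (snd x)))"
    for k and x h :: "real \<times> (complex^'n) \<times> (complex^'n)"
  define F where "F x = ((\<chi> k. G (e (Inl k)) x) :: complex^'n, (\<chi> k. G (e (Inr k)) x) :: complex^'n)" for x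
  define D where "D x h = ((\<chi> k. DG (e (Inl k)) x h) :: complex^'n, (\<chi> k. DG (e (Inr k)) x h) :: complex^'n)" for x h
  have all_e: "(\<forall>k. P (e (Inl k))) \<and> (\<forall>k. P (e (Inr k))) \<longleftrightarrow> (\<forall>k<m. P k) \<and> P m \<and> P (Suc m)" for P
  proof -
    have "(\<forall>k. P (e (Inl k))) \<and> (\<forall>k. P (e (Inr k))) \<longleftrightarrow> (\<forall>x\<in>range e. P x)"
      by (metis rangeE rangeI sum.exhaust)
    also have "range e = {0..<m + 2}" using e by (simp add: bij_betw_def)
    finally show ?thesis by (auto simp: less_Suc_eq)
  qed
  have F0: "F x = 0 \<longleftrightarrow> (\<forall>k<m. G k x = 0) \<and> G m x = 0 \<and> G (Suc m) x = 0" for x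
    using all_e[of "\<lambda>k. G k x = 0"] by (simp add: F_def zero_prod_def vec_eq_iff)
  have D0: "D x h = 0 \<longleftrightarrow> (\<forall>k<m. DG k x h = 0) \<and> DG m x h = 0 \<and> DG (Suc m) x h = 0" for x h
    using all_e[of "\<lambda>k. DG k x h = 0"] by (simp add: D_def zero_prod_def vec_eq_iff)
  have sols: "{z. F (t, z) = 0} = normal_sols m (\<lambda>i. c i + t *\<^sub>R d i) (\<lambda>i. r + t * \<rho> i)" for t
    by (auto simp: F0 G_def normal_sols_def tangent_eq_normal C_def R_def cvec_add_scaleR)
  have normal_config: "normal_sols m c (\<lambda>i. r) = config_sols"
    unfolding normal_sols_def config_sols_def c[symmetric] by auto
  have der: "(F has_derivative D x) (at x)" for x
  proof -
    have "(G k has_derivative DG k x) (at x)" for k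
    proof -
      have C': "((\<lambda>x. C (fst x) k) has_derivative (\<lambda>h. fst h *\<^sub>R cvec (d k))) (at x)"
        unfolding C_def by (auto intro!: derivative_eq_intros)
      have R': "((\<lambda>x. R (fst x) k) has_derivative (\<lambda>h. complex_of_real (fst h * \<rho> k))) (at x)"
        unfolding R_def by (auto intro!: derivative_eq_intros)
      have p: "((\<lambda>x. fst (snd x)) has_derivative (\<lambda>h. fst (snd h))) (at x)"
        and v: "((\<lambda>x. snd (snd x)) has_derivative (\<lambda>h. snd (snd h))) (at x)"
        by (auto intro!: derivative_eq_intros)
      have "((\<lambda>x. sphere_eq (fst (snd x)) (snd (snd x)) (C (fst x) k) (R (fst x) k)) has_derivative
          (\<lambda>h. sphere_eq_deriv (fst (snd x)) (snd (snd x)) (C (fst x) k) (R (fst x) k)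
             (fst (snd h)) (snd (snd h)) (fst h *\<^sub>R cvec (d k)) (complex_of_real (fst h * \<rho> k)))) (at x)"
        by (rule has_derivative_sphere_eq[OF p v C' R'])
      moreover have "((\<lambda>x. cdot (fst (snd x)) (snd (snd x))) has_derivative
          (\<lambda>h. cdot (fst (snd x)) (snd (snd h)) + cdot (fst (snd h)) (snd (snd x)))) (at x)"
        by (rule cdot.FDERIV[OF p v])
      moreover have "((\<lambda>x. cdot (snd (snd x)) (snd (snd x)) - 1) has_derivative
          (\<lambda>h. cdot (snd (snd x)) (snd (snd h)) + cdot (snd (snd h)) (snd (snd x)))) (at x)"
        using has_derivative_diff[OF cdot.FDERIV[OF v v] has_derivative_const[of 1]] by simp
      ultimately show ?thesis
        unfolding G_def DG_def by (cases "k < m"; cases "k = m") simp_all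
    qed
    then show ?thesis
      unfolding F_def D_def by (intro has_derivative_Pair has_derivative_vec_lambda)
  qed
  have cont: "continuous_on UNIV (\<lambda>x. D x h)" for h
  proof -
    have "continuous_on UNIV (\<lambda>x. DG k x h)" for k
    proof -
      have cC: "continuous_on UNIV (\<lambda>x :: real \<times> (complex^'n) \<times> (complex^'n). C (fst x) k)"
        unfolding C_def by (intro continuous_intros)
      have cR: "continuous_on UNIV (\<lambda>x :: real \<times> (complex^'n) \<times> (complex^'n). R (fst x) k)"
        unfolding R_def by (intro continuous_intros)
      show ?thesis
        unfolding DG_def sphere_eq_deriv_def
        by (cases "k < m"; cases "k = m"; simp; intro continuous_intros cC cR cdot.continuous_on)
    qed
    then show ?thesis unfolding D_def by (intro continuous_intros)
  qed
  have inj: "h = 0" if z: "F (0, z) = 0" and h: "D (0, z) (0, h) = 0" for z h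
  proof -
    obtain p v where pv: "z = (p, v)" by (cases z)
    obtain dp dv where dpv: "h = (dp, dv)" by (cases h)
    have "(p, v) \<in> config_sols"
      using z sols[of 0] normal_config by (auto simp: pv)
    moreover have "cdot v dv = 0"
      using h unfolding D0 by (simp add: DG_def pv dpv cdot_commute[of dv v])
    moreover have "cdot dp v + cdot p dv = 0"
      using h unfolding D0 by (simp add: DG_def pv dpv add.commute)
    moreover have "\<forall>x\<in>centers. cdot p dp - cdot dp (cvec x) - cdot v (cvec x) * cdot dv (cvec x) = 0"
    proof
      fix x assume "x \<in> centers"
      then obtain i where "i < m" "x = c i" using c by blast
      then have "DG i (0, z) (0, h) = 0" using h unfolding D0 by blast
      \<comment> \<open>For a direction with zero \<open>t\<close>-component the derivative is twice
        the linear form in \<open>config_jacobian\<close>.\<close>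
      then have "2 * (cdot p dp - cdot dp (cvec (c i)) - cdot v (cvec (c i)) * cdot dv (cvec (c i))) = 0"
        using \<open>i < m\<close>
        by (simp add: DG_def sphere_eq_deriv_def pv dpv C_def cdot.zero_left cdot.zero_right
            cdot_commute[of dp p] algebra_simps)
      then show "cdot p dp - cdot dp (cvec x) - cdot v (cvec x) * cdot dv (cvec x) = 0"
        by (simp only: \<open>x = c i\<close> mult_eq_0_iff zero_neq_numeral[symmetric] simp_thms)
    qed
    ultimately have "dp = 0 \<and> dv = 0" by (rule config_jacobian)
    then show ?thesis by (simp add: dpv zero_prod_def)
  qed
  have sols0: "{z. F (0, z) = 0} = config_sols"
    using sols[of 0] normal_config by simp
  have no_inf: "q = 0 \<and> u = 0" if "cdot u u = 0" "cdot q u = 0" "cdot q q = 0"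
    "\<forall>i<m. 2 * cdot q (cvec (c i)) + (cdot u (cvec (c i)))\<^sup>2 = \<kappa>" for q u :: "complex^'n" and \<kappa>
    using that(4) by (intro config_no_sols_at_infinity[OF that(1-3)]) (auto simp flip: c)
  have "\<exists>B. \<forall>\<^sub>F t in nhds 0. \<forall>z. z \<in> normal_sols m (\<lambda>i. c i + t *\<^sub>R d i) (\<lambda>i. r + t * \<rho> i) \<longrightarrow> norm z \<le> B"
    by (rule normal_sols_bounded[OF _ \<open>m > 0\<close>]) (rule no_inf)
  then obtain B where "\<forall>\<^sub>F t in nhds 0. \<forall>z. z \<in> normal_sols m (\<lambda>i. c i + t *\<^sub>R d i) (\<lambda>i. r + t * \<rho> i) \<longrightarrow> norm z \<le> B"
    by (elim exE)
  then have bounded: "\<forall>\<^sub>F t in nhds 0. \<forall>z. F (t, z) = 0 \<longrightarrow> norm z \<le> B"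
    unfolding sols[symmetric] by simp
  have fin0: "finite {z. F (0, z) = 0}" unfolding sols0 by (rule card_config_sols)
  have "\<forall>\<^sub>F t in nhds 0. finite {z. F (t, z) = 0} \<and> card {z. F (t, z) = 0} = card {z. F (0, z) = 0}"
    by (rule card_zeros_locally_constant[OF der cont _ fin0 bounded]) (rule inj)
  then show ?thesis
    unfolding sols0 card_config_sols(1) sols .
qed

end

subsection \<open>The number of solutions is a constructible function of the parameters\<close>

definition centers_of :: "(nat \<times> 'n option \<Rightarrow> real) \<Rightarrow> nat \<Rightarrow> real^'n" where
  "centers_of x i = (\<chi> k. x (i, Some k))"

definition radii_of :: "(nat \<times> 'n option \<Rightarrow> real) \<Rightarrow> nat \<Rightarrow> real" where
  "radii_of x i = x (i, None)"

lemma of_sphere_params [simp]: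
  "centers_of (sphere_params c r) = c" "radii_of (sphere_params c r) = r"
  by (auto simp: centers_of_def radii_of_def sphere_params_def vec_eq_iff)

text \<open>The unknowns encode a sequence of pairs \<open>(p, v)\<close>.\<close>

definition decode :: "(nat \<times> bool \<times> 'n \<Rightarrow> complex) \<Rightarrow> nat \<Rightarrow> (complex^'n) \<times> (complex^'n)" where
  "decode y b = ((\<chi> k. y (b, True, k)), (\<chi> k. y (b, False, k)))"

lemma decode_surj: "\<exists>y. decode y = f"
  by (rule exI[of _ "\<lambda>(b, j, k). if j then fst (f b) $ k else snd (f b) $ k"])
    (simp add: decode_def fun_eq_iff)

lemma ex_decode: "(\<exists>y. Q (decode y)) \<longleftrightarrow> (\<exists>f. Q f)"
proof
  assume "\<exists>f. Q f"
  then obtain f where "Q f" by (elim exE)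
  moreover obtain y where "decode y = f" using decode_surj[of f] by (elim exE)
  ultimately show "\<exists>y. Q (decode y)" by (intro exI[of _ y]) simp
qed auto

text \<open>Unlike a cardinality, the existence of \<open>N\<close> distinct solutions is a
  condition with quantifiers over finitely many unknowns. Infinite sets are listed apart since their
  \<open>card\<close> is \<open>0\<close>.\<close>

lemma injective_sequence_iff:
  "(\<exists>f :: nat \<Rightarrow> 'a. (\<forall>b<N. f b \<in> S) \<and> (\<forall>b<N. \<forall>b'<b. f b \<noteq> f b')) \<longleftrightarrow> infinite S \<or> N \<le> card S"
proof
  assume "\<exists>f :: nat \<Rightarrow> 'a. (\<forall>b<N. f b \<in> S) \<and> (\<forall>b<N. \<forall>b'<b. f b \<noteq> f b')"
  then obtain f :: "nat \<Rightarrow> 'a" where f: "\<forall>b<N. f b \<in> S" "\<forall>b<N. \<forall>b'<b. f b \<noteq> f b'" by blast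
  have "inj_on f {..<N}"
    by (rule linorder_inj_onI') (use f(2) in \<open>auto dest: not_sym\<close>)
  then show "infinite S \<or> N \<le> card S"
    using card_inj_on_le[of f "{..<N}" S] f(1) by auto
next
  assume "infinite S \<or> N \<le> card S"
  then obtain T where T: "T \<subseteq> S" "finite T" "card T = N"
    by (metis infinite_arbitrarily_large obtain_subset_with_card_n)
  then obtain f where f: "bij_betw f {0..<N} T" using ex_bij_betw_nat_finite by blast
  then have "f b \<noteq> f b'" if "b < N" "b' < b" for b b'
    using inj_onD[OF bij_betw_imp_inj_on[OF f], of b b'] that by auto
  moreover have "f b \<in> S" if "b < N" for b
    using T(1) bij_betw_apply[OF f, of b] that by auto
  ultimately show "\<exists>f :: nat \<Rightarrow> 'a. (\<forall>b<N. f b \<in> S) \<and> (\<forall>b<N. \<forall>b'<b. f b \<noteq> f b')" by blast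
qed

text \<open>The index type of the unknowns may be infinite; a condition that sees only those in the
  finite set \<open>W\<close> can still be quantified over all of them.\<close>

lemma mixed_constructible_ex_all:
  fixes \<phi> :: "('p \<Rightarrow> real) \<times> ('w \<Rightarrow> complex) \<Rightarrow> bool"
  assumes "mixed_constructible \<phi>" "finite W"
    and "\<And>x y y'. (\<And>w. w \<in> W \<Longrightarrow> y w = y' w) \<Longrightarrow> \<phi> (x, y) = \<phi> (x, y')"
  shows "mixed_constructible (\<lambda>a :: ('p \<Rightarrow> real) \<times> ('w \<Rightarrow> complex). \<exists>y. \<phi> (fst a, y))"
proof -
  have "\<phi> (fst a, override_on (snd a) y W) = \<phi> (fst a, y)" for a y
    by (rule assms(3)) simp
  then show ?thesis using mixed_constructible_ex[OF assms(1,2)] by simp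
qed

lemma mixed_polyfun_cdot:
  assumes "\<And>k. mixed_polyfun (\<lambda>a. f a $ k)" "\<And>k. mixed_polyfun (\<lambda>a. g a $ k)"
  shows "mixed_polyfun (\<lambda>a. cdot (f a) (g a))"
  unfolding cdot_def by (intro mixed.R_sum mixed_polyfun.mult assms)

lemma mixed_polyfun_coordinates:
  "mixed_polyfun (\<lambda>a. fst (decode (snd a) b) $ k)" "mixed_polyfun (\<lambda>a. snd (decode (snd a) b) $ k)"
  "mixed_polyfun (\<lambda>a. cvec (centers_of (fst a) i) $ k)"
  "mixed_polyfun (\<lambda>a. complex_of_real (radii_of (fst a) i))"
  by (simp_all add: decode_def cvec_def centers_of_def radii_of_def mixed_polyfun.intros)

lemma mixed_constructible_decode_sol:
  "mixed_constructible (\<lambda>a. decode (snd a) b \<in> normal_sols m (centers_of (fst a)) (radii_of (fst a)))"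
proof -
  let ?p = "\<lambda>a. fst (decode (snd a) b)" and ?v = "\<lambda>a. snd (decode (snd a) b)"
  have "mixed_constructible (\<lambda>a. cdot (?v a) (?v a) = 1 \<and> cdot (?p a) (?v a) = 0 \<and>
     (\<forall>i\<in>{..<m}. tangent_eq (?p a) (?v a) (cvec (centers_of (fst a) i)) (complex_of_real (radii_of (fst a) i))))"
    unfolding tangent_eq_def power2_eq_square
    by (intro constructible.conj mixed.constructible_ball mixed_constructible_eq mixed_polyfun.const
        mixed_polyfun.add mixed_polyfun.mult mixed.R_diff mixed_polyfun_cdot mixed_polyfun_coordinates finite_lessThan)
  then show ?thesis by (simp add: normal_sols_def split_def Ball_def)
qed

lemma mixed_constructible_decode_eq:
  "mixed_constructible (\<lambda>a. decode (snd a) b = decode (snd a) b')"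
proof -
  have "mixed_constructible (\<lambda>a. \<forall>k\<in>UNIV. fst (decode (snd a) b) $ k = fst (decode (snd a) b') $ k \<and>
      snd (decode (snd a) b) $ k = snd (decode (snd a) b') $ k)"
    by (intro constructible.conj mixed.constructible_ball mixed_constructible_eq mixed_polyfun_coordinates finite)
  then show ?thesis by (simp add: prod_eq_iff vec_eq_iff all_conj_distrib)
qed

lemma mixed_constructible_at_least:
  "mixed_constructible (\<lambda>a :: (nat \<times> 'n option \<Rightarrow> real) \<times> (nat \<times> bool \<times> 'n::finite \<Rightarrow> complex).
     infinite (normal_sols m (centers_of (fst a)) (radii_of (fst a))) \<or>
     N \<le> card (normal_sols m (centers_of (fst a)) (radii_of (fst a))))"
proof -
  let ?S = "\<lambda>x. normal_sols m (centers_of x) (radii_of x)"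
  define \<phi> where "\<phi> a \<longleftrightarrow> (\<forall>b\<in>{..<N}. decode (snd a) b \<in> ?S (fst a)) \<and>
      (\<forall>b\<in>{..<N}. \<forall>b'\<in>{..<b}. \<not> decode (snd a) b = decode (snd a) b')"
    for a :: "(nat \<times> 'n option \<Rightarrow> real) \<times> (nat \<times> bool \<times> 'n \<Rightarrow> complex)"
  have "mixed_constructible \<phi>"
    unfolding \<phi>_def
    by (intro constructible.conj constructible.neg mixed.constructible_ball mixed_constructible_decode_sol
        mixed_constructible_decode_eq finite_lessThan)
  then have "mixed_constructible (\<lambda>a :: (nat \<times> 'n option \<Rightarrow> real) \<times> (nat \<times> bool \<times> 'n \<Rightarrow> complex). \<exists>y. \<phi> (fst a, y))"
  proof (rule mixed_constructible_ex_all[of _ "{..<N} \<times> UNIV"])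
    show "finite ({..<N} \<times> (UNIV :: (bool \<times> 'n) set))" by simp
    fix x and y y' :: "nat \<times> bool \<times> 'n \<Rightarrow> complex"
    assume "\<And>w. w \<in> {..<N} \<times> UNIV \<Longrightarrow> y w = y' w"
    then have "decode y b = decode y' b" if "b < N" for b
      using that by (simp add: decode_def)
    then show "\<phi> (x, y) = \<phi> (x, y')" unfolding \<phi>_def by auto
  qed
  moreover have "(\<exists>y. \<phi> (x, y)) \<longleftrightarrow> infinite (?S x) \<or> N \<le> card (?S x)" for x
    using ex_decode[of "\<lambda>f. (\<forall>b<N. f b \<in> ?S x) \<and> (\<forall>b<N. \<forall>b'<b. f b \<noteq> f b')"]
    unfolding injective_sequence_iff[symmetric] \<phi>_def by (simp add: Ball_def)
  ultimately show ?thesis by simp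
qed

lemma mixed_constructible_spanning:
  "mixed_constructible (\<lambda>a :: (nat \<times> 'n option \<Rightarrow> real) \<times> (nat \<times> bool \<times> 'n::finite \<Rightarrow> complex).
     spanning m (centers_of (fst a)))"
proof -
  \<comment> \<open>The vector to be tested is stored in the point slot of pair
    \<open>0\<close>.\<close>
  define \<phi> where "\<phi> a \<longleftrightarrow> (\<forall>i\<in>{..<m}. cdot (fst (decode (snd a) 0)) (cvec (centers_of (fst a) i)) = 0) \<and>
      \<not> (\<forall>k\<in>UNIV. fst (decode (snd a) 0) $ k = 0)"
    for a :: "(nat \<times> 'n option \<Rightarrow> real) \<times> (nat \<times> bool \<times> 'n \<Rightarrow> complex)"
  have "mixed_constructible \<phi>"
    unfolding \<phi>_def
    by (intro constructible.conj constructible.neg mixed.constructible_ball mixed_constructible_eq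
        mixed_polyfun.const mixed_polyfun_cdot mixed_polyfun_coordinates finite_lessThan finite)
  then have "mixed_constructible (\<lambda>a :: (nat \<times> 'n option \<Rightarrow> real) \<times> (nat \<times> bool \<times> 'n \<Rightarrow> complex). \<exists>y. \<phi> (fst a, y))"
  proof (rule mixed_constructible_ex_all[of _ "{0} \<times> UNIV"])
    show "finite ({0 :: nat} \<times> (UNIV :: (bool \<times> 'n) set))" by simp
    fix x and y y' :: "nat \<times> bool \<times> 'n \<Rightarrow> complex"
    assume "\<And>w. w \<in> {0} \<times> UNIV \<Longrightarrow> y w = y' w"
    then have "decode y 0 = decode y' 0" by (simp add: decode_def)
    then show "\<phi> (x, y) = \<phi> (x, y')" unfolding \<phi>_def by simp
  qed
  then have "mixed_constructible (\<lambda>a :: (nat \<times> 'n option \<Rightarrow> real) \<times> (nat \<times> bool \<times> 'n \<Rightarrow> complex). \<not> (\<exists>y. \<phi> (fst a, y)))" by (rule constructible.neg)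
  moreover have "\<not> (\<exists>y. \<phi> (x, y)) \<longleftrightarrow> spanning m (centers_of x)" for x
  proof -
    have "(\<exists>y :: nat \<times> bool \<times> 'n \<Rightarrow> complex. Q (fst (decode y 0))) \<longleftrightarrow> (\<exists>v. Q v)" for Q :: "complex^'n \<Rightarrow> bool"
      unfolding ex_decode[of "\<lambda>f. Q (fst (f 0))"] by (auto intro: exI[of _ "\<lambda>_. (v, 0)" for v])
    from this[of "\<lambda>v. (\<forall>i\<in>{..<m}. cdot v (cvec (centers_of x i)) = 0) \<and> \<not> (\<forall>k\<in>UNIV. v $ k = 0)"]
    show ?thesis unfolding \<phi>_def spanning_def by (simp add: vec_eq_iff Ball_def) blast
  qed
  ultimately show ?thesis by simp
qed

text \<open>Exactly \<open>N\<close> means at least \<open>N\<close> and not at least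
  \<open>Suc N\<close>, the latter also excluding infinite sets. The truth value \<open>G\<close>
  stays open and is decided by an example.\<close>

theorem generic_count:
  "\<exists>P. polyfun P \<and> (\<exists>x. P x \<noteq> 0) \<and>
    (\<exists>G. \<forall>x :: nat \<times> 'n::finite option \<Rightarrow> real. P x \<noteq> 0 \<longrightarrow>
      (finite (normal_sols m (centers_of x) (radii_of x)) \<and>
       card (normal_sols m (centers_of x) (radii_of x)) = N \<and> spanning m (centers_of x)) = G)"
proof -
  let ?L = "\<lambda>N a. infinite (normal_sols m (centers_of (fst a)) (radii_of (fst a))) \<or>
     N \<le> card (normal_sols m (centers_of (fst a)) (radii_of (fst a)))"
  have "mixed_constructible (\<lambda>a :: (nat \<times> 'n option \<Rightarrow> real) \<times> (nat \<times> bool \<times> 'n \<Rightarrow> complex).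
      (?L N a \<and> \<not> ?L (Suc N) a) \<and> spanning m (centers_of (fst a)))"
    by (intro constructible.conj constructible.neg mixed_constructible_at_least mixed_constructible_spanning)
  then have "mixed_constructible (\<lambda>a :: (nat \<times> 'n option \<Rightarrow> real) \<times> (nat \<times> bool \<times> 'n \<Rightarrow> complex).
      finite (normal_sols m (centers_of (fst a)) (radii_of (fst a))) \<and>
      card (normal_sols m (centers_of (fst a)) (radii_of (fst a))) = N \<and> spanning m (centers_of (fst a)))"
    by (rule back_subst[of mixed_constructible]) auto
  from constructible_generically_constant[OF this, of "\<lambda>_. 0"] show ?thesis by simp
qed

section \<open>Comparing the generic truth value with the tetrahedral configuration\<close>

theorem mainTheorem4:
  assumes "CARD('n::finite) \<ge> 3"
  shows "(\<exists>P :: (nat \<times> 'n option \<Rightarrow> real) \<Rightarrow> real.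
            polyfun P \<and> (\<exists>x. P x \<noteq> 0) \<and>
            (\<forall>(c :: nat \<Rightarrow> real^'n) r.
               (\<forall>i < 2 * CARD('n) - 2. r i > 0) \<and> P (sphere_params c r) \<noteq> 0 \<longrightarrow>
               finite (common_tangents (2 * CARD('n) - 2) c r) \<and>
               card (common_tangents (2 * CARD('n) - 2) c r) = 3 * 2 ^ (CARD('n) - 1)))
       \<and> (\<exists>(c :: nat \<Rightarrow> real^'n) r.
            (\<forall>i < 2 * CARD('n) - 2. r i > 0) \<and>
            finite (common_tangents (2 * CARD('n) - 2) c r) \<and>
            card (common_tangents (2 * CARD('n) - 2) c r) = 3 * 2 ^ (CARD('n) - 1) \<and>
            (\<forall>L \<in> common_tangents (2 * CARD('n) - 2) c r. real_line L))"
proof -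
  define m where "m = 2 * CARD('n) - 2"
  \<comment> \<open>Twice the number of lines, as \<open>v\<close> and \<open>- v\<close> give the
    same line.\<close>
  define N where "N = (6 * 2 ^ (CARD('n) - 1) :: nat)"
  obtain i1 i2 i3 :: 'n and J a w X Y r where "tetra_config i1 i2 i3 J a w X Y r"
    using tetra_config_exists[OF assms] by blast
  then interpret tetra_config i1 i2 i3 J a w X Y r .
  obtain c where c: "c ` {..<m} = centers" using enumerate_centers unfolding m_def by blast
  have span: "spanning m c"
    unfolding spanning_def by (auto intro!: config_spanning simp flip: c)
  have tangents: "finite (common_tangents m c r) \<and> card (common_tangents m c r) = 3 * 2 ^ (CARD('n) - 1)"
    if "spanning m c" "finite (normal_sols m c r)" "card (normal_sols m c r) = N" for c :: "nat \<Rightarrow> real^'n" and r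
    using card_common_tangents[OF that(1,2)] that(3) by (simp add: N_def)
  have sols: "normal_sols m c (\<lambda>i. r) = config_sols"
    unfolding normal_sols_def config_sols_def c[symmetric] by auto
  obtain P G where P: "polyfun P" "\<exists>x. P x \<noteq> 0"
    and G: "\<And>x :: nat \<times> 'n option \<Rightarrow> real. P x \<noteq> 0 \<Longrightarrow>
      (finite (normal_sols m (centers_of x) (radii_of x)) \<and>
       card (normal_sols m (centers_of x) (radii_of x)) = N \<and> spanning m (centers_of x)) = G"
    using generic_count[of m N] by blast
  obtain y where y: "P y \<noteq> 0" using P(2) by blast
  \<comment> \<open>The line leads from the tetrahedral configuration, where \<open>P\<close> may
    vanish, to a point where it does not.\<close>
  define x0 where "x0 = sphere_params c (\<lambda>i. r)"
  define x where "x t = (\<lambda>k. x0 k + t * (y k - x0 k))" for t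
  have x: "centers_of (x t) = (\<lambda>i. c i + t *\<^sub>R (centers_of y i - c i))"
    "radii_of (x t) = (\<lambda>i. r + t * (radii_of y i - r))" for t
    by (auto simp: x_def x0_def centers_of_def radii_of_def sphere_params_def vec_eq_iff)
  have "\<forall>\<^sub>F t in nhds 0. (finite (normal_sols m (centers_of (x t)) (radii_of (x t))) \<and>
       card (normal_sols m (centers_of (x t)) (radii_of (x t))) = N) \<and> spanning m (centers_of (x t))"
    unfolding x N_def
    by (intro eventually_conj[OF config_persists[OF m_def c] spanning_persists[OF span]])
  then obtain e where e: "e > 0" "\<And>t. \<bar>t\<bar> < e \<Longrightarrow> finite (normal_sols m (centers_of (x t)) (radii_of (x t))) \<and>
       card (normal_sols m (centers_of (x t)) (radii_of (x t))) = N \<and> spanning m (centers_of (x t))"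
    unfolding eventually_nhds_metric dist_real_def conj_assoc diff_0_right by (elim exE conjE) simp
  obtain t where t: "0 < t" "t < e" "P (x t) \<noteq> 0"
    using polyfun_nonzero_near[of P y e x0, OF P(1) y e(1)] unfolding x_def by (elim exE conjE)
  \<comment> \<open>At this \<open>t\<close> both \<open>P (x t) \<noteq> 0\<close> and the correct
    count hold, so the generic truth value is \<open>True\<close>.\<close>
  then have "G" using G[of "x t"] e(2)[of t] by simp
  have 1: "finite (common_tangents m c r) \<and> card (common_tangents m c r) = 3 * 2 ^ (CARD('n) - 1)"
    if "P (sphere_params c r) \<noteq> 0" for c :: "nat \<Rightarrow> real^'n" and r
    using G[OF that] \<open>G\<close> tangents[of c r] by simp
  have 2: "finite (common_tangents m c (\<lambda>i. r)) \<and> card (common_tangents m c (\<lambda>i. r)) = 3 * 2 ^ (CARD('n) - 1)"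
    using tangents[OF span, of "\<lambda>i. r"] card_config_sols by (simp add: sols N_def)
  have 3: "real_line L" if L: "L \<in> common_tangents m c (\<lambda>i. r)" for L
  proof -
    obtain p v where pv: "(p, v) \<in> config_sols" "L = line_of p v"
      using L unfolding common_tangents_eq_image[OF span] sols by auto
    then obtain p' v' where "p = cvec p'" "v = cvec v'" using config_sols_real by blast
    moreover from this have "v' \<noteq> 0"
      using pv(1) by (auto simp: config_sols_def cdot_def cvec_def)
    ultimately show ?thesis using pv(2) unfolding real_line_def by blast
  qed
  show ?thesis
    unfolding m_def[symmetric]
  proof (intro conjI)
    show "\<exists>P :: (nat \<times> 'n option \<Rightarrow> real) \<Rightarrow> real. polyfun P \<and> (\<exists>x. P x \<noteq> 0) \<and>
        (\<forall>(c :: nat \<Rightarrow> real^'n) r. (\<forall>i<m. r i > 0) \<and> P (sphere_params c r) \<noteq> 0 \<longrightarrow>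
          finite (common_tangents m c r) \<and> card (common_tangents m c r) = 3 * 2 ^ (CARD('n) - 1))"
      using P 1 by (intro exI[of _ P]) simp
    show "\<exists>(c :: nat \<Rightarrow> real^'n) r. (\<forall>i<m. r i > 0) \<and> finite (common_tangents m c r) \<and>
        card (common_tangents m c r) = 3 * 2 ^ (CARD('n) - 1) \<and> (\<forall>L\<in>common_tangents m c r. real_line L)"
      using 2 3 pos(5) by (intro exI[of _ c] exI[of _ "\<lambda>i. r"]) simp
  qed
qed

end
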